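(* Let $H(w,p)=\langle w,p^2\rangle$ and, for $k\ge 1$, $I_k(w,p)=\langle A_k(w)\Gamma(w)p,p\rangle$ for $(w,p)\in\mathcal{H}^{1,+}_0\times\mathcal{H}^{1,+}_0$. Then: (i) the functions $I_k:\mathcal{H}^{1,+}_0\times\mathcal{H}^{1,+}_0\to\mathbb{C}$, $k\ge 1$, are analytic integrals of the Hamiltonian flow of $H$ (i.e. each $I_k$ is analytic and $\{I_k,H\}=0$); (ii) $\{I_k,I_l\}=0$ for any $k,l\ge 1$.
   Context: All spaces are complex, and "analytic" means complex-analytic between (open subsets of) complex Banach spaces. $\mathbb{T}=\mathbb{R}/\mathbb{Z}$, $f_k=\int_0^1 f(y)e^{-2\pi i k y}\,dy$ are Fourier coefficients, $\langle k\rangle:=|k|$ for $k\neq0$, $\langle0\rangle:=1$. $\mathcal{H}^1$ is the Hilbert space of functions $f:\mathbb{T}\to\mathbb{C}$ with $\|f\|_{\mathcal{H}^1}=(\sum_{k\in\mathbb{Z}}|f_k|^2\langle k\rangle^2)^{1/2}<\infty$ (a Banach algebra under pointwise multiplication). $\mathcal{H}^{1,+}=\{f\in\mathcal{H}^1: f_k=0 \text{ for } k<0\}$, $\mathcal{H}^{1,+}_0=\{f\in\mathcal{H}^1: f_k=0\text{ for }k\le 0\}$, and $\Pi^+,\Pi^+_0$ are the corresponding Fourier-truncation projections of $\mathcal{H}^1$ onto these subspaces. The bilinear pairing is $\langle f,g\rangle=\sum_{k\in\mathbb{Z}}f_kg_k$, and $\check f(y):=f(-y)$. Shift: $(Lf)(y)=f(y)e^{-2\pi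 i y}$. For $w\in\mathcal{H}^{1,+}_0$ and $k\ge1$, $A_k(w):\mathcal{H}^{1,+}_0\to\mathcal{H}^{1,+}_0$ is the bounded operator $A_k(w)f=f\,\Pi^+(L^{k+1}w)-w\,\Pi^+(L^{k+1}f)$. The Hankel operator is $\Gamma(w):\mathcal{H}^{1,+}_0\to\mathcal{H}^{1,+}_0$, $\Gamma(w)p=\Pi^+_0(w\check p)$. Poisson bracket: for a $C^1$ function $F$ on $\mathcal{H}^{1,+}_0\times\mathcal{H}^{1,+}_0$ the gradients $\nabla_wF,\nabla_pF$ are the distributions on $\mathbb{T}$ with Fourier coefficients vanishing for $k\le0$ determined by $\langle\nabla_wF,\delta w\rangle=(D_1F)(\delta w)$, $\langle\nabla_pF,\delta p\rangle=(D_2F)(\delta p)$ for all $\delta w,\delta p\in\mathcal{H}^{1,+}_0$, where $D_1,D_2$ are the partial differentials in $w$ and $p$. The Hamiltonian vector field is $X_F=(\nabla_pF,-\nabla_wF)$ and $\{F,G\}=dG(X_F)=\langle\nabla_pF,\nabla_wG\rangle-\langle\nabla_wF,\nabla_pG\rangle$ (whenever this is defined). The Hamiltonian equation of $F$ is $(\dot w,\dot p)=X_F(w,p)$. *)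

theory Defs
  imports "HOL-Analysis.Analysis"
begin

section \<open>Complex normed spaces, analytic maps, complex \<open>C\<^sup>1\<close> functions\<close>

class complex_normed_vector = real_normed_vector +
  fixes scaleC :: "complex \<Rightarrow> 'a \<Rightarrow> 'a" (infixr "*\<^sub>C" 75)
  assumes scaleC_add_right: "a *\<^sub>C (x + y) = a *\<^sub>C x + a *\<^sub>C y"
    and scaleC_add_left: "(a + b) *\<^sub>C x = a *\<^sub>C x + b *\<^sub>C x"
    and scaleC_scaleC: "a *\<^sub>C b *\<^sub>C x = (a * b) *\<^sub>C x"
    and scaleC_of_real: "complex_of_real r *\<^sub>C x = r *\<^sub>R x"
    and norm_scaleC: "norm (a *\<^sub>C x) = cmod a * norm x"

instantiation complex :: complex_normed_vector
begin

definition scaleC_complex :: "complex \<Rightarrow> complex \<Rightarrow> complex"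
  where "scaleC_complex a x = a * x"

instance
  by standard (simp_all add: scaleC_complex_def algebra_simps norm_mult scaleR_conv_of_real)

end

instantiation prod :: (complex_normed_vector, complex_normed_vector) complex_normed_vector
begin

definition scaleC_prod :: "complex \<Rightarrow> 'a \<times> 'b \<Rightarrow> 'a \<times> 'b"
  where "scaleC_prod a x = (a *\<^sub>C fst x, a *\<^sub>C snd x)"

instance
proof
  fix a b :: complex and r :: real and x y :: "'a \<times> 'b"
  show "a *\<^sub>C (x + y) = a *\<^sub>C x + a *\<^sub>C y"
    by (simp add: scaleC_prod_def scaleC_add_right)
  show "(a + b) *\<^sub>C x = a *\<^sub>C x + b *\<^sub>C x"
    by (simp add: scaleC_prod_def scaleC_add_left)
  show "a *\<^sub>C b *\<^sub>C x = (a * b) *\<^sub>C x"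
    by (simp add: scaleC_prod_def scaleC_scaleC)
  show "complex_of_real r *\<^sub>C x = r *\<^sub>R x"
    by (simp add: scaleC_prod_def scaleC_of_real scaleR_prod_def)
  have "(norm (a *\<^sub>C x))\<^sup>2 = (cmod a * norm x)\<^sup>2"
    by (simp add: scaleC_prod_def norm_prod_def norm_scaleC power_mult_distrib algebra_simps)
  then show "norm (a *\<^sub>C x) = cmod a * norm x"
    by (simp add: power2_eq_iff_nonneg)
qed

end

text \<open>Bounded complex \<open>n\<close>-linear maps. The arguments are \<open>v 0, \<dots>, v (n - 1)\<close>; the remaining
  entries of \<open>v\<close> are irrelevant.\<close>

definition multilinear_bound ::
    "nat \<Rightarrow> ((nat \<Rightarrow> 'a::complex_normed_vector) \<Rightarrow> 'b::complex_normed_vector) \<Rightarrow> real \<Rightarrow> bool"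
  where "multilinear_bound n a M \<longleftrightarrow>
    (\<forall>u v. (\<forall>i<n. u i = v i) \<longrightarrow> a u = a v) \<and>
    (\<forall>v i c x y. i < n \<longrightarrow> a (v(i := x + c *\<^sub>C y)) = a (v(i := x)) + c *\<^sub>C a (v(i := y))) \<and>
    (\<forall>v. norm (a v) \<le> M * (\<Prod>i<n. norm (v i)))"

text \<open>Near every point \<open>f\<close> is the sum of a normally convergent power series
  \<open>\<Sum>n. a n (h, \<dots>, h)\<close>.\<close>

definition complex_analytic_on ::
    "('a::complex_normed_vector \<Rightarrow> 'b::complex_normed_vector) \<Rightarrow> 'a set \<Rightarrow> bool"
  where "complex_analytic_on f U \<longleftrightarrow> open U \<and>
    (\<forall>x\<in>U. \<exists>r>0. \<exists>a M. ball x r \<subseteq> U \<and> (\<forall>n. multilinear_bound n (a n) (M n)) \<and>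
       summable (\<lambda>n. M n * r ^ n) \<and>
       (\<forall>h. norm h < r \<longrightarrow> (\<lambda>n. a n (\<lambda>_. h)) sums f (x + h)))"

definition complex_C1 :: "('a::complex_normed_vector \<Rightarrow> complex) \<Rightarrow> bool"
  where "complex_C1 F \<longleftrightarrow> (\<exists>F' :: 'a \<Rightarrow> ('a \<Rightarrow>\<^sub>L complex).
    continuous_on UNIV F' \<and>
    (\<forall>x. (F has_derivative blinfun_apply (F' x)) (at x)) \<and>
    (\<forall>x c v. blinfun_apply (F' x) (c *\<^sub>C v) = c * blinfun_apply (F' x) v))"


section \<open>Fourier series on the circle\<close>

text \<open>Functions on \<open>\<real>/\<int>\<close> are \<open>1\<close>-periodic functions on \<open>\<real>\<close>.\<close>

definition fcoeff :: "(real \<Rightarrow> complex) \<Rightarrow> int \<Rightarrow> complex"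
  where "fcoeff f k = integral {0..1} (\<lambda>y. f y * cis (- (2 * pi * of_int k * y)))"

definition jbracket :: "int \<Rightarrow> real"
  where "jbracket k = (if k = 0 then 1 else \<bar>of_int k\<bar>)"

text \<open>Every class in the Sobolev space has a unique continuous representative, because finiteness
  of the norm makes the Fourier series absolutely convergent.\<close>

definition H1 :: "(real \<Rightarrow> complex) set"
  where "H1 = {f. continuous_on UNIV f \<and> (\<forall>y. f (y + 1) = f y) \<and>
    (\<lambda>k. (cmod (fcoeff f k))\<^sup>2 * (jbracket k)\<^sup>2) summable_on UNIV}"

definition H1_norm :: "(real \<Rightarrow> complex) \<Rightarrow> real"
  where "H1_norm f = sqrt (\<Sum>\<^sub>\<infinity>k. (cmod (fcoeff f k))\<^sup>2 * (jbracket k)\<^sup>2)"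

definition H1_plus0 :: "(real \<Rightarrow> complex) set"
  where "H1_plus0 = {f \<in> H1. \<forall>k\<le>0. fcoeff f k = 0}"

definition proj_plus :: "(real \<Rightarrow> complex) \<Rightarrow> real \<Rightarrow> complex"
  where "proj_plus f y = (\<Sum>\<^sub>\<infinity>k\<in>{0..}. fcoeff f k * cis (2 * pi * of_int k * y))"

definition proj_plus0 :: "(real \<Rightarrow> complex) \<Rightarrow> real \<Rightarrow> complex"
  where "proj_plus0 f y = (\<Sum>\<^sub>\<infinity>k\<in>{1..}. fcoeff f k * cis (2 * pi * of_int k * y))"

definition shift :: "(real \<Rightarrow> complex) \<Rightarrow> real \<Rightarrow> complex"
  where "shift f y = f y * cis (- (2 * pi * y))"

definition check :: "(real \<Rightarrow> complex) \<Rightarrow> real \<Rightarrow> complex"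
  where "check f y = f (- y)"

text \<open>The bilinear pairing, in terms of Fourier coefficients (so that it also applies to
  distributions) and for functions.\<close>

definition coeff_pairing :: "(int \<Rightarrow> complex) \<Rightarrow> (int \<Rightarrow> complex) \<Rightarrow> complex"
  where "coeff_pairing a b = (\<Sum>\<^sub>\<infinity>k. a k * b k)"

definition pairing :: "(real \<Rightarrow> complex) \<Rightarrow> (real \<Rightarrow> complex) \<Rightarrow> complex"
  where "pairing f g = coeff_pairing (fcoeff f) (fcoeff g)"


section \<open>The Hilbert space of functions with positive frequencies\<close>

lemma fcoeff_integrable:
  assumes "continuous_on UNIV f"
  shows "(\<lambda>y. f y * cis (- (2 * pi * of_int k * y))) integrable_on {0..1}"
  by (intro integrable_continuous_real continuous_intros continuous_on_subset[OF assms]) auto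

lemma fcoeff_0 [simp]: "fcoeff (\<lambda>_. 0) k = 0"
  by (simp add: fcoeff_def)

lemma fcoeff_add:
  assumes "continuous_on UNIV f" "continuous_on UNIV g"
  shows "fcoeff (\<lambda>y. f y + g y) k = fcoeff f k + fcoeff g k"
  unfolding fcoeff_def distrib_right
  by (rule integral_add) (intro fcoeff_integrable assms)+

lemma fcoeff_cmult: "fcoeff (\<lambda>y. c * f y) k = c * fcoeff f k"
  unfolding fcoeff_def mult.assoc by (rule integral_mult_right)

lemma fcoeff_cis_mult:
  "fcoeff (\<lambda>y. cis (2 * pi * of_int m * y) * f y) k = fcoeff f (k - m)"
proof -
  have "cis (2 * pi * of_int m * y) * f y * cis (- (2 * pi * of_int k * y)) =
        f y * cis (- (2 * pi * of_int (k - m) * y))" for y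
  proof -
    have "cis (2 * pi * of_int m * y) * cis (- (2 * pi * of_int k * y)) =
          cis (- (2 * pi * of_int (k - m) * y))"
      by (simp add: cis_mult algebra_simps)
    then show ?thesis by (metis mult.assoc mult.commute)
  qed
  then show ?thesis by (simp only: fcoeff_def)
qed

lemma null_mult_real_polynomial:
  assumes "real_polynomial_function q" "continuous_on UNIV f" "\<And>k. fcoeff f k = 0"
  shows "fcoeff (\<lambda>y. complex_of_real (q (cis (2 * pi * y))) * f y) k = 0"
  using assms
proof (induction q arbitrary: f k rule: real_polynomial_function.induct)
  case (linear q)
  then interpret q: bounded_linear q by simp
  define c where "c = (complex_of_real (q 1) - \<i> * complex_of_real (q \<i>)) / 2"
  define d where "d = (complex_of_real (q 1) + \<i> * complex_of_real (q \<i>)) / 2"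
  have q: "complex_of_real (q z) = c * z + d * cnj z" for z
  proof -
    have "z = Re z *\<^sub>R 1 + Im z *\<^sub>R \<i>"
      by (simp add: complex_eq_iff)
    then have "q z = Re z * q 1 + Im z * q \<i>"
      by (metis q.add q.scaleR real_scaleR_def)
    then show ?thesis
      by (simp add: c_def d_def complex_eq_iff field_simps)
  qed
  have "(\<lambda>y. complex_of_real (q (cis (2 * pi * y))) * f y) =
        (\<lambda>y. c * (cis (2 * pi * of_int 1 * y) * f y) + d * (cis (2 * pi * of_int (-1) * y) * f y))"
    by (simp add: q algebra_simps cis_cnj)
  then show ?case
    using linear
    by (subst \<open>_ = (\<lambda>y. c * _ y + d * _ y)\<close>, subst fcoeff_add)
       (auto intro!: continuous_intros simp only: fcoeff_cmult fcoeff_cis_mult, auto)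
next
  case (const c)
  then show ?case by (simp add: fcoeff_cmult)
next
  case (add p q)
  have "continuous_on UNIV (\<lambda>y. complex_of_real (r (cis (2 * pi * y))) * f y)"
    if "real_polynomial_function r" for r :: "complex \<Rightarrow> real"
    by (intro continuous_intros add.prems
          continuous_on_compose2[OF continuous_on_polymonial_function[of r UNIV]])
       (use that in \<open>auto simp: real_polynomial_function_eq\<close>)
  then show ?case
    using add by (simp add: distrib_right fcoeff_add)
next
  case (mult p q)
  have "continuous_on UNIV (\<lambda>y. complex_of_real (q (cis (2 * pi * y))) * f y)"
    by (intro continuous_intros mult.prems
          continuous_on_compose2[OF continuous_on_polymonial_function[of q UNIV]])
       (use mult.hyps in \<open>auto simp: real_polynomial_function_eq\<close>)
  from mult.IH(1)[OF this mult.IH(2)[OF mult.prems]] show ?case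
    by (simp add: mult.assoc)
qed


lemma continuous_null_eq_0:
  assumes f: "continuous_on UNIV f" and per: "\<And>y. f (y + 1) = f y"
    and null: "\<And>k. fcoeff f k = 0"
  shows "f = (\<lambda>_. 0)"
proof -
  have per_int: "f (y + of_int n) = f y" for y n
  proof (induction n rule: int_induct[where k = 0])
    case (step1 i)
    then show ?case using per[of "y + of_int i"] by (simp add: algebra_simps)
  next
    case (step2 i)
    then show ?case using per[of "y + of_int (i - 1)"] by (simp add: algebra_simps)
  qed simp
  define F where "F z = f (Arg z / (2 * pi))" for z
  have F_eqI: "F z = f (t / (2 * pi))" if "z = of_real (norm z) * cis t" "z \<noteq> 0" for z t
  proof -
    have "cis (Arg z) = cis t"
      using that cis_Arg[of z] by (simp add: sgn_eq) (metis mult_cancel_left nonzero_mult_div_cancel_left norm_eq_zero of_real_eq_0_iff)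
    then obtain n :: int where "Arg z = t + 2 * pi * of_int n"
      using sin_cos_eq_iff[of "Arg z" t] by (auto simp: complex_eq_iff)
    then have "Arg z / (2 * pi) = t / (2 * pi) + of_int n" by (simp add: field_simps)
    then show ?thesis by (simp add: F_def per_int)
  qed
  have F_cis: "F (cis (2 * pi * y)) = f y" for y
    by (subst F_eqI[where t = "2 * pi * y"]) auto
  have isCont_f: "isCont f y" for y
    using f by (simp add: continuous_on_eq_continuous_at)
  have "isCont F z" if "z \<noteq> 0" for z
  proof (cases "z \<in> \<real>\<^sub>\<le>\<^sub>0")
    case False
    then have "isCont (\<lambda>z. Arg z / (2 * pi)) z"
      by (intro continuous_intros continuous_at_Arg) auto
    then show ?thesis unfolding F_def by (rule isCont_o2) (rule isCont_f)
  next
    case True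
    with that have "z \<notin> \<real>\<^sub>\<ge>\<^sub>0"
      by (auto simp: complex_nonneg_Reals_iff complex_nonpos_Reals_iff complex_eq_iff)
    then have "isCont (\<lambda>z. Arg2pi z / (2 * pi)) z"
      by (intro continuous_intros continuous_at_Arg2pi) auto
    then have c: "isCont (\<lambda>z. f (Arg2pi z / (2 * pi))) z" by (rule isCont_o2) (rule isCont_f)
    have ev: "eventually (\<lambda>w. f (Arg2pi w / (2 * pi)) = F w) (nhds z)"
    proof -
      have "eventually (\<lambda>w. w \<noteq> 0) (nhds z)"
        using that by (rule t1_space_nhds)
      then show ?thesis
      proof eventually_elim
        case (elim w)
        have "w = of_real (norm w) * cis (Arg2pi w)"
          using Arg2pi_eq[of w] by (simp add: cis_conv_exp)
        then show ?case using F_eqI elim by metis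
      qed
    qed
    show ?thesis using c isCont_cong[OF ev] by simp
  qed
  then have contF: "continuous_on (sphere 0 1) F"
    by (intro continuous_at_imp_continuous_on ballI) (metis mem_sphere_0 norm_zero zero_neq_one)
  have contN: "continuous_on {0..1} (\<lambda>y. (cmod (f y))\<^sup>2)"
    by (intro continuous_intros continuous_on_subset[OF f]) auto
  have contn: "continuous_on {0..1} (\<lambda>y. cmod (f y))"
    by (intro continuous_intros continuous_on_subset[OF f]) auto
  define N where "N = integral {0..1} (\<lambda>y. (cmod (f y))\<^sup>2)"
  define B where "B = integral {0..1} (\<lambda>y. cmod (f y))"
  have B0: "B \<ge> 0" unfolding B_def
    by (rule integral_nonneg) (auto intro: integrable_continuous_real contn)
  have bound: "N \<le> e * B" if "e > 0" for e
  proof -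
    obtain g where g: "polynomial_function g" "\<And>z. z \<in> sphere 0 1 \<Longrightarrow> cmod (F z - g z) < e"
      using Stone_Weierstrass_polynomial_function[OF compact_sphere contF \<open>e > 0\<close>] by blast
    define G where "G y = g (cis (2 * pi * y))" for y
    have near: "cmod (f y - G y) < e" for y
      using g(2)[of "cis (2 * pi * y)"] by (simp add: F_cis G_def)
    have contG: "continuous_on UNIV G" unfolding G_def
      by (rule continuous_on_compose2[OF continuous_on_polymonial_function[OF g(1)]])
         (auto intro!: continuous_intros)
    have Re: "real_polynomial_function (\<lambda>z. Re (g z))" and Im: "real_polynomial_function (\<lambda>z. Im (g z))"
      using g(1) bounded_linear_Re bounded_linear_Im unfolding polynomial_function_def
      by (auto simp: o_def)
    have contRe: "continuous_on UNIV (\<lambda>y. complex_of_real (Re (G y)) * f y)"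
      and contIm: "continuous_on UNIV (\<lambda>y. (- \<i>) * (complex_of_real (Im (G y)) * f y))"
      by (intro continuous_intros contG f)+
    have "fcoeff (\<lambda>y. complex_of_real (Re (G y)) * f y) 0 = 0"
      "fcoeff (\<lambda>y. complex_of_real (Im (G y)) * f y) 0 = 0"
      using null_mult_real_polynomial[OF Re f null] null_mult_real_polynomial[OF Im f null]
      unfolding G_def by auto
    then have "fcoeff (\<lambda>y. complex_of_real (Re (G y)) * f y +
        (- \<i>) * (complex_of_real (Im (G y)) * f y)) 0 = 0"
      by (simp only: fcoeff_add[OF contRe contIm] fcoeff_cmult) simp
    moreover have "(\<lambda>y. complex_of_real (Re (G y)) * f y + (- \<i>) * (complex_of_real (Im (G y)) * f y))
        = (\<lambda>y. f y * cnj (G y))"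
      by (auto simp: complex_eq_iff algebra_simps)
    ultimately have 0: "integral {0..1} (\<lambda>y. f y * cnj (G y)) = 0"
      by (simp add: fcoeff_def)
    have int1: "(\<lambda>y. f y * cnj (f y)) integrable_on {0..1}"
      and int2: "(\<lambda>y. f y * cnj (G y)) integrable_on {0..1}"
      and int3: "(\<lambda>y. f y * cnj (f y - G y)) integrable_on {0..1}"
      by (intro integrable_continuous_real continuous_intros continuous_on_subset[OF f]
            continuous_on_subset[OF contG]; simp)+
    have "complex_of_real N = integral {0..1} (\<lambda>y. complex_of_real ((cmod (f y))\<^sup>2))"
      unfolding N_def
      using integral_linear[OF integrable_continuous_real[OF contN] bounded_linear_of_real[where 'a = complex]]
      by (simp add: o_def)
    also have "\<dots> = integral {0..1} (\<lambda>y. f y * cnj (f y))"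
      by (simp only: complex_norm_square)
    also have "\<dots> = integral {0..1} (\<lambda>y. f y * cnj (f y - G y))"
      using integral_diff[OF int1 int2] 0 by (simp add: right_diff_distrib)
    finally have "cmod (complex_of_real N) = cmod (integral {0..1} (\<lambda>y. f y * cnj (f y - G y)))"
      by simp
    also have "\<dots> \<le> integral {0..1} (\<lambda>y. e * cmod (f y))"
    proof (rule integral_norm_bound_integral)
      show "(\<lambda>y. e * cmod (f y)) integrable_on {0..1}"
        by (intro integrable_continuous_real continuous_intros contn)
      show "cmod (f y * cnj (f y - G y)) \<le> e * cmod (f y)" for y
        using mult_right_mono[OF less_imp_le[OF near[of y]], of "cmod (f y)"]
        by (simp add: norm_mult mult.commute del: complex_cnj_diff)
    qed (rule int3)
    also have "\<dots> = e * B" by (simp add: B_def)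
    finally show ?thesis by simp
  qed
  have "N \<le> 0"
  proof (rule field_le_epsilon)
    fix d :: real assume "d > 0"
    have "N \<le> d / (B + 1) * B" using \<open>d > 0\<close> B0 by (intro bound) simp
    also have "\<dots> \<le> 0 + d" using \<open>d > 0\<close> B0 by (simp add: field_simps)
    finally show "N \<le> 0 + d" .
  qed
  moreover have "N \<ge> 0" unfolding N_def
    by (rule integral_nonneg) (auto intro: integrable_continuous_real contN)
  ultimately have "\<forall>y\<in>{0..1}. (cmod (f y))\<^sup>2 = 0"
    using integral_eq_0_iff[OF contN] unfolding N_def by simp
  then have "f y = 0" if "y \<in> {0..1}" for y using that by simp
  moreover have "f y = f (frac y)" for y
    using per_int[of "frac y" "\<lfloor>y\<rfloor>"] by (simp add: frac_def)
  ultimately show ?thesis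
    by (intro ext) (metis atLeastAtMost_iff frac_ge_0 frac_lt_1 less_imp_le)
qed

lemma l2_add:
  fixes a b :: "'i \<Rightarrow> complex"
  assumes a: "(\<lambda>k. (cmod (a k))\<^sup>2) summable_on UNIV" and b: "(\<lambda>k. (cmod (b k))\<^sup>2) summable_on UNIV"
  shows "(\<lambda>k. (cmod (a k + b k))\<^sup>2) summable_on UNIV"
    and "sqrt (\<Sum>\<^sub>\<infinity>k. (cmod (a k + b k))\<^sup>2) \<le>
         sqrt (\<Sum>\<^sub>\<infinity>k. (cmod (a k))\<^sup>2) + sqrt (\<Sum>\<^sub>\<infinity>k. (cmod (b k))\<^sup>2)"
proof -
  define A where "A = sqrt (\<Sum>\<^sub>\<infinity>k. (cmod (a k))\<^sup>2)"
  define B where "B = sqrt (\<Sum>\<^sub>\<infinity>k. (cmod (b k))\<^sup>2)"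
  have nonneg: "A \<ge> 0" "B \<ge> 0" by (auto simp: A_def B_def intro!: infsum_nonneg)
  have fin: "(\<Sum>k\<in>S. (cmod (a k + b k))\<^sup>2) \<le> (A + B)\<^sup>2" if "finite S" for S
  proof -
    have "sqrt (\<Sum>k\<in>S. (cmod (a k + b k))\<^sup>2) \<le> L2_set (\<lambda>k. cmod (a k) + cmod (b k)) S"
      unfolding L2_set_def
      by (intro real_sqrt_le_mono sum_mono power_mono norm_triangle_ineq) auto
    also have "\<dots> \<le> L2_set (\<lambda>k. cmod (a k)) S + L2_set (\<lambda>k. cmod (b k)) S"
      by (rule L2_set_triangle_ineq)
    also have "\<dots> \<le> A + B"
      unfolding L2_set_def A_def B_def
      by (intro add_mono real_sqrt_le_mono finite_sum_le_infsum a b that) auto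
    finally show ?thesis using nonneg by (metis add_nonneg_nonneg sqrt_le_D)
  qed
  show s: "(\<lambda>k. (cmod (a k + b k))\<^sup>2) summable_on UNIV"
    by (rule nonneg_bdd_above_summable_on) (use fin in \<open>auto intro!: bdd_aboveI[of _ "(A + B)\<^sup>2"]\<close>)
  have "(\<Sum>\<^sub>\<infinity>k. (cmod (a k + b k))\<^sup>2) \<le> (A + B)\<^sup>2"
    by (rule infsum_le_finite_sums[OF s]) (use fin in auto)
  then show "sqrt (\<Sum>\<^sub>\<infinity>k. (cmod (a k + b k))\<^sup>2) \<le>
         sqrt (\<Sum>\<^sub>\<infinity>k. (cmod (a k))\<^sup>2) + sqrt (\<Sum>\<^sub>\<infinity>k. (cmod (b k))\<^sup>2)"
    using nonneg unfolding A_def[symmetric] B_def[symmetric]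
    by (intro real_le_lsqrt) auto
qed

lemma H1_weighted:
  "(cmod (fcoeff f k))\<^sup>2 * (jbracket k)\<^sup>2 = (cmod (fcoeff f k * complex_of_real (jbracket k)))\<^sup>2"
  by (simp add: norm_mult power_mult_distrib)

lemma H1_add: "f \<in> H1 \<Longrightarrow> g \<in> H1 \<Longrightarrow> (\<lambda>y. f y + g y) \<in> H1"
  unfolding H1_def mem_Collect_eq H1_weighted
  using l2_add(1)[of "\<lambda>k. fcoeff f k * complex_of_real (jbracket k)" "\<lambda>k. fcoeff g k * complex_of_real (jbracket k)"]
  by (auto simp: fcoeff_add distrib_right intro!: continuous_intros)

lemma H1_norm_add:
  assumes "f \<in> H1" "g \<in> H1"
  shows "H1_norm (\<lambda>y. f y + g y) \<le> H1_norm f + H1_norm g"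
  using assms l2_add(2)[of "\<lambda>k. fcoeff f k * complex_of_real (jbracket k)" "\<lambda>k. fcoeff g k * complex_of_real (jbracket k)"]
  unfolding H1_norm_def H1_weighted H1_def mem_Collect_eq
  by (simp add: fcoeff_add distrib_right)

lemma H1_cmult:
  assumes "f \<in> H1"
  shows "(\<lambda>y. c * f y) \<in> H1" "H1_norm (\<lambda>y. c * f y) = cmod c * H1_norm f"
proof -
  have eq: "(cmod (fcoeff (\<lambda>y. c * f y) k))\<^sup>2 * (jbracket k)\<^sup>2 =
      (cmod c)\<^sup>2 * ((cmod (fcoeff f k))\<^sup>2 * (jbracket k)\<^sup>2)" for k
    by (simp add: fcoeff_cmult norm_mult power_mult_distrib)
  show "(\<lambda>y. c * f y) \<in> H1"
    using assms unfolding H1_def mem_Collect_eq eq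
    by (auto intro!: continuous_intros summable_on_cmult_right)
  show "H1_norm (\<lambda>y. c * f y) = cmod c * H1_norm f"
    unfolding H1_norm_def eq by (simp add: infsum_cmult_right' real_sqrt_mult)
qed

lemma H1_norm_eq_0:
  assumes f: "f \<in> H1" and "H1_norm f = 0"
  shows "f = (\<lambda>_. 0)"
proof (rule continuous_null_eq_0)
  fix k
  have "(cmod (fcoeff f k))\<^sup>2 * (jbracket k)\<^sup>2 = 0"
    using assms unfolding H1_norm_def H1_def
    by (intro nonneg_infsum_le_0D[where A = UNIV and f = "\<lambda>k. (cmod (fcoeff f k))\<^sup>2 * (jbracket k)\<^sup>2"]) auto
  then show "fcoeff f k = 0" by (auto simp: jbracket_def split: if_splits)
qed (use f in \<open>auto simp: H1_def\<close>)

lemma H1_plus0_add: "f \<in> H1_plus0 \<Longrightarrow> g \<in> H1_plus0 \<Longrightarrow> (\<lambda>y. f y + g y) \<in> H1_plus0"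
  unfolding H1_plus0_def by (auto intro: H1_add) (auto simp: fcoeff_add H1_def)

lemma H1_plus0_cmult: "f \<in> H1_plus0 \<Longrightarrow> (\<lambda>y. c * f y) \<in> H1_plus0"
  unfolding H1_plus0_def by (auto intro: H1_cmult simp: fcoeff_cmult)

lemma H1_plus0_0: "(\<lambda>_. 0) \<in> H1_plus0"
  by (auto simp: H1_plus0_def H1_def intro!: continuous_intros)

typedef hplus0 = H1_plus0 morphisms fn Abs_hplus0
  using H1_plus0_0 by blast

setup_lifting type_definition_hplus0

instantiation hplus0 :: complex_normed_vector
begin

lift_definition zero_hplus0 :: hplus0 is "\<lambda>_. 0"
  by (rule H1_plus0_0)

lift_definition plus_hplus0 :: "hplus0 \<Rightarrow> hplus0 \<Rightarrow> hplus0" is "\<lambda>f g y. f y + g y"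
  by (rule H1_plus0_add)

lift_definition scaleC_hplus0 :: "complex \<Rightarrow> hplus0 \<Rightarrow> hplus0" is "\<lambda>c f y. c * f y"
  by (rule H1_plus0_cmult)

lift_definition norm_hplus0 :: "hplus0 \<Rightarrow> real" is H1_norm .

definition scaleR_hplus0 :: "real \<Rightarrow> hplus0 \<Rightarrow> hplus0"
  where "scaleR_hplus0 r f = complex_of_real r *\<^sub>C f"

definition uminus_hplus0 :: "hplus0 \<Rightarrow> hplus0"
  where "uminus_hplus0 f = (- 1) *\<^sub>C f"

definition minus_hplus0 :: "hplus0 \<Rightarrow> hplus0 \<Rightarrow> hplus0"
  where "minus_hplus0 f g = f + (- g)"

definition dist_hplus0 :: "hplus0 \<Rightarrow> hplus0 \<Rightarrow> real"
  where "dist_hplus0 f g = norm (f - g)"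

definition sgn_hplus0 :: "hplus0 \<Rightarrow> hplus0"
  where "sgn_hplus0 f = inverse (norm f) *\<^sub>R f"

definition uniformity_hplus0 :: "(hplus0 \<times> hplus0) filter"
  where "uniformity_hplus0 = (INF e\<in>{0<..}. principal {(f, g). dist f g < e})"

definition open_hplus0 :: "hplus0 set \<Rightarrow> bool"
  where "open_hplus0 U \<longleftrightarrow> (\<forall>f\<in>U. \<forall>\<^sub>F (f', g) in uniformity. f' = f \<longrightarrow> g \<in> U)"

instance
proof
  fix f g h :: hplus0 and a b :: complex and r s :: real
  show "f + g + h = f + (g + h)" "f + g = g + f" "0 + f = f"
    by (transfer; simp add: algebra_simps)+
  show "- f + f = 0" unfolding uminus_hplus0_def by transfer simp
  show "f - g = f + - g" by (simp add: minus_hplus0_def)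
  show C1: "a *\<^sub>C (f + g) = a *\<^sub>C f + a *\<^sub>C g" for a and f g :: hplus0
    by transfer (simp add: algebra_simps)
  show C2: "(a + b) *\<^sub>C f = a *\<^sub>C f + b *\<^sub>C f" for a b and f :: hplus0
    by transfer (simp add: algebra_simps)
  show C3: "a *\<^sub>C b *\<^sub>C f = (a * b) *\<^sub>C f" for a b and f :: hplus0
    by transfer (simp add: algebra_simps)
  show "complex_of_real r *\<^sub>C f = r *\<^sub>R f" by (simp add: scaleR_hplus0_def)
  show "r *\<^sub>R (f + g) = r *\<^sub>R f + r *\<^sub>R g" by (simp add: scaleR_hplus0_def C1)
  show "(r + s) *\<^sub>R f = r *\<^sub>R f + s *\<^sub>R f" by (simp add: scaleR_hplus0_def C2)
  show "r *\<^sub>R s *\<^sub>R f = (r * s) *\<^sub>R f" by (simp add: scaleR_hplus0_def C3)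
  show "1 *\<^sub>R f = f" unfolding scaleR_hplus0_def by transfer simp
  show nC: "norm (a *\<^sub>C f) = cmod a * norm f" for a
    by transfer (auto simp: H1_plus0_def H1_cmult)
  show "norm (r *\<^sub>R f) = \<bar>r\<bar> * norm f" by (simp add: scaleR_hplus0_def nC)
  show "norm (f + g) \<le> norm f + norm g"
    by transfer (auto simp: H1_plus0_def H1_norm_add)
  show "norm f = 0 \<longleftrightarrow> f = 0"
  proof
    show "norm f = 0 \<Longrightarrow> f = 0"
      by transfer (auto simp: H1_plus0_def dest: H1_norm_eq_0)
  qed (transfer, simp add: H1_norm_def)
  show "dist f g = norm (f - g)" "sgn f = inverse (norm f) *\<^sub>R f"
    "(uniformity :: (hplus0 \<times> hplus0) filter) = (INF e\<in>{0<..}. principal {(f, g). dist f g < e})"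
    by (rule dist_hplus0_def sgn_hplus0_def uniformity_hplus0_def)+
  show "open U \<longleftrightarrow> (\<forall>f\<in>U. \<forall>\<^sub>F (f', g) in uniformity. f' = f \<longrightarrow> g \<in> U)" for U :: "hplus0 set"
    by (rule open_hplus0_def)
qed

end


section \<open>Gradients and the Poisson bracket on the phase space\<close>

type_synonym phase_space = "hplus0 \<times> hplus0"

text \<open>A distribution on the circle is represented by its Fourier coefficients, which are exactly
  the sequences of at most polynomial growth.\<close>

definition is_distribution :: "(int \<Rightarrow> complex) \<Rightarrow> bool"
  where "is_distribution g \<longleftrightarrow> (\<exists>C n. \<forall>k. cmod (g k) \<le> C * jbracket k ^ n)"

definition has_gradient_w :: "(phase_space \<Rightarrow> complex) \<Rightarrow> phase_space \<Rightarrow> (int \<Rightarrow> complex) \<Rightarrow> bool"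
  where "has_gradient_w F z g \<longleftrightarrow> is_distribution g \<and> (\<forall>k\<le>0. g k = 0) \<and>
    (\<exists>D. ((\<lambda>w. F (w, snd z)) has_derivative D) (at (fst z)) \<and>
         (\<forall>v. ((\<lambda>k. g k * fcoeff (fn v) k) has_sum D v) UNIV))"

definition has_gradient_p :: "(phase_space \<Rightarrow> complex) \<Rightarrow> phase_space \<Rightarrow> (int \<Rightarrow> complex) \<Rightarrow> bool"
  where "has_gradient_p F z g \<longleftrightarrow> is_distribution g \<and> (\<forall>k\<le>0. g k = 0) \<and>
    (\<exists>D. ((\<lambda>p. F (fst z, p)) has_derivative D) (at (snd z)) \<and>
         (\<forall>v. ((\<lambda>k. g k * fcoeff (fn v) k) has_sum D v) UNIV))"

definition gradient_w :: "(phase_space \<Rightarrow> complex) \<Rightarrow> phase_space \<Rightarrow> int \<Rightarrow> complex"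
  where "gradient_w F z = (THE g. has_gradient_w F z g)"

definition gradient_p :: "(phase_space \<Rightarrow> complex) \<Rightarrow> phase_space \<Rightarrow> int \<Rightarrow> complex"
  where "gradient_p F z = (THE g. has_gradient_p F z g)"

definition poisson_bracket ::
    "(phase_space \<Rightarrow> complex) \<Rightarrow> (phase_space \<Rightarrow> complex) \<Rightarrow> phase_space \<Rightarrow> complex"
  where "poisson_bracket F G z =
    coeff_pairing (gradient_p F z) (gradient_w G z) - coeff_pairing (gradient_w F z) (gradient_p G z)"

text \<open>The bracket is only meaningful where the gradients exist and both pairings converge.\<close>

definition poisson_defined ::
    "(phase_space \<Rightarrow> complex) \<Rightarrow> (phase_space \<Rightarrow> complex) \<Rightarrow> phase_space \<Rightarrow> bool"
  where "poisson_defined F G z \<longleftrightarrow> complex_C1 F \<and> complex_C1 G \<and>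
    (\<exists>!g. has_gradient_w F z g) \<and> (\<exists>!g. has_gradient_p F z g) \<and>
    (\<exists>!g. has_gradient_w G z g) \<and> (\<exists>!g. has_gradient_p G z g) \<and>
    (\<lambda>k. gradient_p F z k * gradient_w G z k) summable_on UNIV \<and>
    (\<lambda>k. gradient_w F z k * gradient_p G z k) summable_on UNIV"

definition poisson_commute :: "(phase_space \<Rightarrow> complex) \<Rightarrow> (phase_space \<Rightarrow> complex) \<Rightarrow> bool"
  where "poisson_commute F G \<longleftrightarrow> (\<forall>z. poisson_defined F G z \<and> poisson_bracket F G z = 0)"

definition analytic_integral :: "(phase_space \<Rightarrow> complex) \<Rightarrow> (phase_space \<Rightarrow> complex) \<Rightarrow> bool"
  where "analytic_integral F H \<longleftrightarrow> complex_analytic_on F UNIV \<and> poisson_commute F H"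


section \<open>The Hamiltonian and the functions \<open>I\<^sub>k\<close>\<close>

definition A_op :: "nat \<Rightarrow> (real \<Rightarrow> complex) \<Rightarrow> (real \<Rightarrow> complex) \<Rightarrow> real \<Rightarrow> complex"
  where "A_op k w f y =
    f y * proj_plus ((shift ^^ (k + 1)) w) y - w y * proj_plus ((shift ^^ (k + 1)) f) y"

definition Hankel :: "(real \<Rightarrow> complex) \<Rightarrow> (real \<Rightarrow> complex) \<Rightarrow> real \<Rightarrow> complex"
  where "Hankel w p = proj_plus0 (\<lambda>y. w y * check p y)"

definition Ham :: "phase_space \<Rightarrow> complex"
  where "Ham z = (let w = fn (fst z); p = fn (snd z) in pairing w (\<lambda>y. (p y)\<^sup>2))"

definition I_fun :: "nat \<Rightarrow> phase_space \<Rightarrow> complex"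
  where "I_fun k z = (let w = fn (fst z); p = fn (snd z) in pairing (A_op k w (Hankel w p)) p)"

end

theory Submission
  imports Defs "HOL-Computational_Algebra.Formal_Power_Series"
begin

text \<open>In Fourier coefficients \<open>w\<^sub>k\<close> and \<open>p\<^sub>k\<close> are conjugate variables. Consider the moments \<open>w\<^sub>m\<close>,
  \<open>u\<^sub>m = \<Sum>\<^sub>j w\<^bsub>m+j\<^esub> p\<^sub>j\<close> and \<open>v\<^sub>m = \<Sum>\<^bsub>i,j\<^esub> w\<^bsub>m+i+j\<^esub> p\<^sub>i p\<^sub>j\<close>. Then \<open>H = v\<^sub>0\<close>, and since the
  infinite parts of the two products in \<open>A\<^sub>k(w)f\<close> cancel,
  \<open>I\<^sub>k = \<Sum>\<^bsub>i+j=k+1\<^esub> (u\<^sub>i u\<^sub>j - w\<^sub>i v\<^sub>j)\<close> with \<open>i, j \<ge> 1\<close>. The moments form an \<open>sl\<^sub>2\<close> current algebra,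
  \<open>{u\<^sub>m, w\<^sub>n} = w\<^bsub>m+n\<^esub>\<close>, \<open>{v\<^sub>m, w\<^sub>n} = 2 u\<^bsub>m+n\<^esub>\<close>, \<open>{v\<^sub>m, u\<^sub>n} = v\<^bsub>m+n\<^esub>\<close>, all other brackets being \<open>0\<close>, and
  the \<open>I\<^sub>k\<close> are the coefficients of the determinant \<open>u(x)\<^sup>2 - w(x) v(x)\<close> of generating series.
  Summing \<open>h\<^bsub>m+n\<^esub> x\<^sup>m y\<^sup>n\<close> over \<open>m, n \<ge> 1\<close> gives \<open>(y h(x) - x h(y)) / (x - y)\<close>, a combination of \<open>h(x)\<close> and
  \<open>h(y)\<close>; hence the bracket of the determinants at \<open>x\<close> and at \<open>y\<close> is a \<open>3 \<times> 3\<close> determinant with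
  linearly dependent rows.\<close>


section \<open>Fourier synthesis of summable sequences\<close>

text \<open>For complex families \<^const>\<open>summable_on\<close> means absolute summability, so
  \<open>a summable_on UNIV\<close> says that \<open>a\<close> is an \<open>\<ell>\<^sup>1\<close> sequence.\<close>

lemma summable_on_times:
  fixes a :: "'i \<Rightarrow> complex" and b :: "'j \<Rightarrow> complex"
  assumes "a summable_on A" "b summable_on B"
  shows "(\<lambda>(i, j). a i * b j) summable_on A \<times> B"
proof -
  have a: "(\<lambda>i. norm (a i)) summable_on A" and b: "(\<lambda>j. norm (b j)) summable_on B"
    using assms by (simp_all flip: summable_on_iff_abs_summable_on_complex)
  have "(\<lambda>(i, j). norm (a i) * norm (b j)) summable_on A \<times> B"
    by (rule summable_on_SigmaI[where g = "\<lambda>i. norm (a i) * (\<Sum>\<^sub>\<infinity>j\<in>B. norm (b j))"])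
       (auto intro!: has_sum_cmult_right has_sum_infsum summable_on_cmult_left a b)
  then show ?thesis
    by (simp add: summable_on_iff_abs_summable_on_complex case_prod_unfold norm_mult)
qed

lemma summable_on_mult_bounded:
  fixes a b :: "'i \<Rightarrow> complex"
  assumes "a summable_on A" "\<And>i. i \<in> A \<Longrightarrow> norm (b i) \<le> C"
  shows "(\<lambda>i. a i * b i) summable_on A"
proof -
  have "(\<lambda>i. norm (a i) * C) summable_on A"
    using assms(1) by (intro summable_on_cmult_left) (simp flip: summable_on_iff_abs_summable_on_complex)
  then have "(\<lambda>i. norm (a i * b i)) summable_on A"
    by (rule Infinite_Sum.abs_summable_on_comparison_test') (auto simp: norm_mult intro!: mult_left_mono assms)
  then show ?thesis by (simp add: summable_on_iff_abs_summable_on_complex)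
qed

lemma norm_le_infsum_norm:
  fixes a :: "'i \<Rightarrow> complex"
  assumes "a summable_on UNIV"
  shows "norm (a i) \<le> (\<Sum>\<^sub>\<infinity>i. norm (a i))"
  using finite_sum_le_infsum[of "\<lambda>i. norm (a i)" UNIV "{i}"] assms
  by (simp add: summable_on_iff_abs_summable_on_complex)

lemma summable_on_shift [simp]:
  fixes a :: "int \<Rightarrow> complex"
  shows "(\<lambda>k. a (k + n)) summable_on UNIV \<longleftrightarrow> a summable_on UNIV"
    and "(\<lambda>k. a (n + k)) summable_on UNIV \<longleftrightarrow> a summable_on UNIV"
    and "(\<lambda>k. a (k - n)) summable_on UNIV \<longleftrightarrow> a summable_on UNIV"
    and "(\<lambda>k. a (n - k)) summable_on UNIV \<longleftrightarrow> a summable_on UNIV"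
    and "(\<lambda>k. a (- k)) summable_on UNIV \<longleftrightarrow> a summable_on UNIV"
  subgoal by (rule summable_on_reindex_bij_witness[of _ "\<lambda>k. k - n" "\<lambda>k. k + n"]) auto
  subgoal by (rule summable_on_reindex_bij_witness[of _ "\<lambda>k. k - n" "\<lambda>k. n + k"]) auto
  subgoal by (rule summable_on_reindex_bij_witness[of _ "\<lambda>k. k + n" "\<lambda>k. k - n"]) auto
  subgoal by (rule summable_on_reindex_bij_witness[of _ "\<lambda>k. n - k" "\<lambda>k. n - k"]) auto
  subgoal by (rule summable_on_reindex_bij_witness[of _ uminus uminus]) auto
  done

lemma summable_on_restrict:
  fixes a :: "'i \<Rightarrow> complex"
  assumes "a summable_on UNIV"
  shows "(\<lambda>k. if P k then a k else 0) summable_on UNIV"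
proof -
  have "a summable_on {k. P k}" using assms by (rule summable_on_subset) auto
  then show ?thesis by (rule summable_on_cong_neutral[THEN iffD1, rotated -1]) auto
qed

section \<open>Convolution of summable sequences\<close>

definition conv :: "(int \<Rightarrow> complex) \<Rightarrow> (int \<Rightarrow> complex) \<Rightarrow> int \<Rightarrow> complex"
  where "conv a b n = (\<Sum>\<^sub>\<infinity>j. a (n - j) * b j)"

text \<open>The shear \<open>(i, j)\<close> to \<open>(i + j, j)\<close> is a bijection of the
  integer lattice that carries the product family \<open>a i * b j\<close> to this one. Summability
  of the double family is what later permits summing over \<open>j\<close> first and exchanging
  sums.\<close>

lemma conv_pairs_summable:
  fixes a b :: "int \<Rightarrow> complex"
  assumes "a summable_on UNIV" "b summable_on UNIV"
  shows "(\<lambda>(n, j). a (n - j) * b j) summable_on (UNIV :: (int \<times> int) set)"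
proof -
  have "(\<lambda>(i, j). a i * b j) summable_on (UNIV :: (int \<times> int) set)"
    using summable_on_times[OF assms] by simp
  then show ?thesis
    by (subst summable_on_reindex_bij_witness[of UNIV "\<lambda>(i, j). (i + j, j)" "\<lambda>(n, j). (n - j, j)" UNIV
        "\<lambda>(i, j). a i * b j"]) auto
qed

lemma conv_summable:
  assumes "a summable_on UNIV" "b summable_on UNIV"
  shows "conv a b summable_on UNIV"
  unfolding conv_def[abs_def]
  by (rule summable_on_Sigma_banach) (use conv_pairs_summable[OF assms] in simp)

section \<open>Synthesis as the inverse of \<open>fcoeff\<close> on summable sequences\<close>

definition synth :: "(int \<Rightarrow> complex) \<Rightarrow> real \<Rightarrow> complex"
  where "synth a y = (\<Sum>\<^sub>\<infinity>k. a k * cis (2 * pi * of_int k * y))"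

lemma synth_summable:
  "a summable_on UNIV \<Longrightarrow> (\<lambda>k. a k * cis (2 * pi * of_int k * y)) summable_on UNIV"
  by (rule summable_on_mult_bounded[where C = 1]) auto

lemma continuous_on_synth:
  assumes "a summable_on UNIV"
  shows "continuous_on UNIV (synth a)"
proof (rule uniform_limit_theorem)
  show "uniform_limit UNIV (\<lambda>K y. \<Sum>k\<in>K. a k * cis (2 * pi * of_int k * y)) (synth a)
          (finite_subsets_at_top UNIV)"
    unfolding synth_def[abs_def]
    by (rule Weierstrass_m_test_general[where M = "\<lambda>k. norm (a k)"])
       (use assms in \<open>auto simp: norm_mult summable_on_iff_abs_summable_on_complex\<close>)
qed (auto intro!: always_eventually continuous_intros)

lemma synth_periodic: "synth a (y + 1) = synth a y"
proof -
  have "cis (2 * pi * of_int k * (y + 1)) = cis (2 * pi * of_int k * y)" for k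
    by (simp add: distrib_left cis_multiple_2pi flip: cis_mult)
  then show ?thesis by (simp add: synth_def)
qed

text \<open>For \<open>k\<close> different from 0 the character has a primitive with equal values at
  the two ends of the unit interval.\<close>

lemma fcoeff_1: "fcoeff (\<lambda>_. 1) k = (if k = 0 then 1 else 0)"
proof (cases "k = 0")
  case False
  define c where "c = - (2 * pi * of_int k)"
  have c: "c \<noteq> 0" using False by (simp add: c_def)
  have "((\<lambda>y. cis (c * y)) has_integral (cis (c * 1) / (\<i> * c) - cis (c * 0) / (\<i> * c))) {0..1}"
  proof (rule fundamental_theorem_of_calculus)
    fix y :: real
    have "((\<lambda>z. exp (\<i> * of_real c * z) / (\<i> * of_real c)) has_field_derivative exp (\<i> * of_real c * of_real y)) (at (of_real y))"
      using c by (auto intro!: derivative_eq_intros)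
    then have "((\<lambda>y. exp (\<i> * of_real c * of_real y) / (\<i> * of_real c)) has_vector_derivative exp (\<i> * of_real c * of_real y)) (at y within {0..1})"
      by (rule has_vector_derivative_real_field)
    then show "((\<lambda>y. cis (c * y) / (\<i> * c)) has_vector_derivative cis (c * y)) (at y within {0..1})"
      by (simp add: cis_conv_exp mult.assoc)
  qed simp
  moreover have "cis c = 1" using cis_multiple_2pi[of "of_int (- k)"] by (simp add: c_def)
  ultimately have "((\<lambda>y. cis (c * y)) has_integral 0) {0..1}" by simp
  then show ?thesis using False by (simp add: fcoeff_def c_def integral_unique)
qed (simp add: fcoeff_def)

text \<open>Since \<open>g\<close> is bounded on the unit interval, the series of
  \<open>synth a\<close> times \<open>g\<close> converges uniformly there and may be integrated term
  by term; a character in front of \<open>g\<close> only shifts the coefficient index. The case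
  \<open>g = 1\<close> inverts synthesis, and the case \<open>g = synth b\<close> yields
  convolution.\<close>

lemma fcoeff_synth_mult:
  assumes a: "a summable_on UNIV" and g: "continuous_on UNIV g"
  shows "((\<lambda>k. a k * fcoeff g (n - k)) has_sum fcoeff (\<lambda>y. synth a y * g y) n) UNIV"
proof -
  define e where "e k y = cis (2 * pi * of_int k * y)" for k y
  define h where "h k y = a k * (e k y * g y) * cis (- (2 * pi * of_int n * y))" for k y
  have "bounded (g ` {0..1})"
    by (intro compact_imp_bounded compact_continuous_image continuous_on_subset[OF g]) auto
  then obtain G where G: "\<And>y. y \<in> {0..1} \<Longrightarrow> norm (g y) \<le> G"
    unfolding bounded_iff by (metis imageI)
  have lim: "uniform_limit {0..1} (\<lambda>K y. \<Sum>k\<in>K. h k y) (\<lambda>y. \<Sum>\<^sub>\<infinity>k. h k y) (finite_subsets_at_top UNIV)"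
  proof (rule Weierstrass_m_test_general)
    show "norm (h k y) \<le> norm (a k) * G" if "y \<in> {0..1}" for k y
      using G[OF that] by (auto simp: h_def e_def norm_mult intro!: mult_left_mono)
    show "(\<lambda>k. norm (a k) * G) summable_on UNIV"
      using a by (intro summable_on_cmult_left) (simp flip: summable_on_iff_abs_summable_on_complex)
  qed
  have int: "h k integrable_on {0..1}" for k
    unfolding h_def e_def
    by (intro integrable_continuous_real continuous_intros continuous_on_subset[OF g]) auto
  have hint: "integral {0..1} (h k) = a k * fcoeff g (n - k)" for k
  proof -
    have "integral {0..1} (h k) = a k * fcoeff (\<lambda>y. e k y * g y) n"
      unfolding h_def[abs_def] mult.assoc fcoeff_def by (rule integral_mult_right)
    then show ?thesis by (simp add: e_def fcoeff_cis_mult)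
  qed
  have "((\<lambda>K. integral {0..1} (\<lambda>y. \<Sum>k\<in>K. h k y)) \<longlongrightarrow> integral {0..1} (\<lambda>y. \<Sum>\<^sub>\<infinity>k. h k y))
          (finite_subsets_at_top UNIV)"
  proof (rule uniform_limit_integral[OF lim])
    show "continuous_on {0..1} (\<lambda>y. \<Sum>k\<in>K. h k y)" for K
      unfolding h_def e_def by (intro continuous_intros continuous_on_subset[OF g]) auto
    fix I J
    assume I: "\<And>K. ((\<lambda>y. \<Sum>k\<in>K. h k y) has_integral I K) {0..1}"
      and J: "((\<lambda>y. \<Sum>\<^sub>\<infinity>k. h k y) has_integral J) {0..1}"
      and "(I \<longlongrightarrow> J) (finite_subsets_at_top UNIV)"
    moreover have "integral {0..1} (\<lambda>y. \<Sum>k\<in>K. h k y) = I K" for K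
      using I by (rule integral_unique)
    ultimately show ?thesis by (simp add: integral_unique[OF J])
  qed simp
  also have "(\<lambda>y. \<Sum>\<^sub>\<infinity>k. h k y) = (\<lambda>y. synth a y * g y * cis (- (2 * pi * of_int n * y)))"
  proof
    fix y
    have "(\<Sum>\<^sub>\<infinity>k. h k y) = (\<Sum>\<^sub>\<infinity>k. a k * e k y * (g y * cis (- (2 * pi * of_int n * y))))"
      by (simp add: h_def mult_ac)
    then show "(\<Sum>\<^sub>\<infinity>k. h k y) = synth a y * g y * cis (- (2 * pi * of_int n * y))"
      unfolding infsum_cmult_left' by (simp add: synth_def e_def)
  qed
  \<comment> \<open>\<open>has_sum\<close> is convergence along the finite index sets, and the
    integral of a finite partial sum is the partial sum of the terms
    \<open>a k * fcoeff g (n - k)\<close>.\<close>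
  finally show ?thesis
    unfolding has_sum_def fcoeff_def[of "\<lambda>y. synth a y * g y"]
    by (rule Lim_transform_eventually)
       (use hint int in \<open>auto simp: integral_sum eventually_finite_subsets_at_top_weakI\<close>)
qed

lemma fcoeff_synth:
  assumes a: "a summable_on UNIV"
  shows "fcoeff (synth a) n = a n"
proof -
  have "((\<lambda>k. a k * fcoeff (\<lambda>_. 1) (n - k)) has_sum fcoeff (\<lambda>y. synth a y * 1) n) UNIV"
    by (rule fcoeff_synth_mult[OF a]) simp
  moreover have "((\<lambda>k. a k * fcoeff (\<lambda>_. 1) (n - k)) has_sum a n) UNIV"
    by (rule has_sum_finite_neutralI[of "{n}"]) (auto simp: fcoeff_1)
  ultimately show ?thesis by (simp add: has_sum_unique)
qed

lemma fcoeff_diff: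
  assumes "continuous_on UNIV f" "continuous_on UNIV g"
  shows "fcoeff (\<lambda>y. f y - g y) k = fcoeff f k - fcoeff g k"
  unfolding fcoeff_def left_diff_distrib
  by (rule integral_diff) (intro fcoeff_integrable assms)+

text \<open>The difference of the two sides is continuous and periodic with vanishing coefficients,
  so \<open>continuous_null_eq_0\<close> applies.\<close>

lemma synth_fcoeff:
  assumes "continuous_on UNIV f" "\<And>y. f (y + 1) = f y" "fcoeff f summable_on UNIV"
  shows "synth (fcoeff f) = f"
proof -
  have "(\<lambda>y. synth (fcoeff f) y - f y) = (\<lambda>_. 0)"
    by (rule continuous_null_eq_0)
       (auto intro!: continuous_intros continuous_on_synth assms
          simp: fcoeff_diff fcoeff_synth synth_periodic assms continuous_on_synth)
  then show ?thesis by (auto simp: fun_eq_iff)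
qed

text \<open>By \<open>fcoeff_synth_mult\<close> the product has the coefficients
  \<open>conv a b\<close>, which are summable; a continuous periodic function with summable
  coefficients is recovered from them.\<close>

lemma synth_mult:
  assumes "a summable_on UNIV" "b summable_on UNIV"
  shows "(\<lambda>y. synth a y * synth b y) = synth (conv a b)"
proof -
  have "fcoeff (\<lambda>y. synth a y * synth b y) n = conv a b n" for n
  proof -
    have "((\<lambda>k. a k * b (n - k)) has_sum fcoeff (\<lambda>y. synth a y * synth b y) n) UNIV"
      using fcoeff_synth_mult[OF assms(1) continuous_on_synth[OF assms(2)], of n]
      by (simp add: fcoeff_synth assms)
    also have "?this \<longleftrightarrow> ((\<lambda>k. a (n - k) * b k) has_sum fcoeff (\<lambda>y. synth a y * synth b y) n) UNIV"
      by (rule has_sum_reindex_bij_witness[of _ "\<lambda>k. n - k" "\<lambda>k. n - k"]) auto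
    finally show ?thesis by (simp add: conv_def infsumI)
  qed
  then have "fcoeff (\<lambda>y. synth a y * synth b y) = conv a b" by (rule ext)
  then show ?thesis
    using synth_fcoeff[of "\<lambda>y. synth a y * synth b y"] assms
    by (simp add: conv_summable synth_periodic continuous_on_synth continuous_on_mult)
qed

lemma synth_check:
  "check (synth a) = synth (\<lambda>k. a (- k))"
  unfolding check_def synth_def fun_eq_iff
  by (intro allI infsum_reindex_bij_witness[of _ uminus uminus]) auto

lemma synth_cis_mult: "synth a y * cis (2 * pi * of_int m * y) = synth (\<lambda>k. a (k - m)) y"
proof -
  have "synth a y * cis (2 * pi * of_int m * y) =
      (\<Sum>\<^sub>\<infinity>k. a k * cis (2 * pi * of_int k * y) * cis (2 * pi * of_int m * y))"
    by (simp add: synth_def infsum_cmult_left')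
  also have "\<dots> = synth (\<lambda>k. a (k - m)) y" unfolding synth_def
    by (rule infsum_reindex_bij_witness[of _ "\<lambda>k. k - m" "\<lambda>k. k + m"])
       (auto simp: mult.assoc cis_mult algebra_simps)
  finally show ?thesis .
qed

lemma shift_synth: "(shift ^^ n) (synth a) = synth (\<lambda>k. a (k + int n))"
proof (induction n)
  case (Suc n)
  then show ?case
    using synth_cis_mult[of "\<lambda>k. a (k + int n)" _ "-1"]
    by (auto simp: fun_eq_iff shift_def algebra_simps)
qed simp

lemma proj_plus_synth:
  assumes "a summable_on UNIV"
  shows "proj_plus (synth a) = synth (\<lambda>k. if k \<ge> 0 then a k else 0)"
  unfolding proj_plus_def[abs_def] synth_def[of "\<lambda>k. if _ k then _ k else _"] fun_eq_iff fcoeff_synth[OF assms]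
  by (intro allI infsum_cong_neutral) auto

lemma proj_plus0_synth:
  assumes "a summable_on UNIV"
  shows "proj_plus0 (synth a) = synth (\<lambda>k. if k \<ge> 1 then a k else 0)"
  unfolding proj_plus0_def[abs_def] synth_def[of "\<lambda>k. if _ k then _ k else _"] fun_eq_iff fcoeff_synth[OF assms]
  by (intro allI infsum_cong_neutral) auto


section \<open>The moments of the phase space\<close>

lemma has_sum_diff:
  fixes f g :: "'i \<Rightarrow> complex"
  assumes "(f has_sum a) A" "(g has_sum b) A"
  shows "((\<lambda>i. f i - g i) has_sum (a - b)) A"
  using has_sum_add[OF assms(1) has_sum_uminusI[OF assms(2)]] by simp

lemma has_sum_sum:
  fixes f :: "'k \<Rightarrow> 'i \<Rightarrow> complex"
  assumes "\<And>k. k \<in> K \<Longrightarrow> (f k has_sum a k) A"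
  shows "((\<lambda>i. \<Sum>k\<in>K. f k i) has_sum (\<Sum>k\<in>K. a k)) A"
  using assms by (induction K rule: infinite_finite_induct) (auto intro!: has_sum_add)

lemma summable_on_mult:
  fixes a b :: "'i \<Rightarrow> complex"
  assumes "a summable_on UNIV" "b summable_on UNIV"
  shows "(\<lambda>i. a i * b i) summable_on UNIV"
  by (rule summable_on_mult_bounded[OF assms(1) norm_le_infsum_norm[OF assms(2)]])

section \<open>Correlation: contracting a shifted sequence against another one\<close>

definition corr :: "(int \<Rightarrow> complex) \<Rightarrow> (int \<Rightarrow> complex) \<Rightarrow> int \<Rightarrow> complex"
  where "corr a b m = (\<Sum>\<^sub>\<infinity>j. a (m + j) * b j)"

lemma corr_eq_conv: "corr a b = conv a (\<lambda>j. b (- j))"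
  unfolding corr_def conv_def fun_eq_iff
  by (intro allI infsum_reindex_bij_witness[of _ uminus uminus]) auto

lemma corr_summable:
  "a summable_on UNIV \<Longrightarrow> b summable_on UNIV \<Longrightarrow> corr a b summable_on UNIV"
  by (simp add: corr_eq_conv conv_summable)

lemma corr_has_sum:
  assumes "a summable_on UNIV" "b summable_on UNIV"
  shows "((\<lambda>j. a (m + j) * b j) has_sum corr a b m) UNIV"
  unfolding corr_def using assms by (intro has_sum_infsum summable_on_mult) auto

lemma corr_add_left:
  assumes "a summable_on UNIV" "a' summable_on UNIV" "b summable_on UNIV"
  shows "corr (\<lambda>k. a k + a' k) b m = corr a b m + corr a' b m"
  using has_sum_add[OF corr_has_sum[OF assms(1,3)] corr_has_sum[OF assms(2,3)]]
  by (simp add: corr_def infsumI distrib_right)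

lemma corr_add_right:
  assumes "a summable_on UNIV" "b summable_on UNIV" "b' summable_on UNIV"
  shows "corr a (\<lambda>k. b k + b' k) m = corr a b m + corr a b' m"
  using has_sum_add[OF corr_has_sum[OF assms(1,2)] corr_has_sum[OF assms(1,3)]]
  by (simp add: corr_def infsumI distrib_left)

lemma corr_cmult_left: "corr (\<lambda>k. c * a k) b m = c * corr a b m"
  by (simp add: corr_def mult.assoc infsum_cmult_right')

lemma corr_cmult_right: "corr a (\<lambda>k. c * b k) m = c * corr a b m"
  by (simp add: corr_def mult.left_commute[of _ c] infsum_cmult_right')

text \<open>A sup norm times l1 norm estimate. Asking only for a sup bound on the first argument
  lets it be iterated, with a correlation itself as first argument.\<close>

lemma norm_corr_le:
  assumes "\<And>k. norm (a k) \<le> A" "b summable_on UNIV"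
  shows "norm (corr a b m) \<le> A * (\<Sum>\<^sub>\<infinity>j. norm (b j))"
proof -
  have b: "(\<lambda>j. norm (b j)) summable_on UNIV"
    using assms(2) by (simp flip: summable_on_iff_abs_summable_on_complex)
  have "(\<lambda>j. b j * a (m + j)) summable_on UNIV"
    by (rule summable_on_mult_bounded) (use assms in auto)
  then have "((\<lambda>j. a (m + j) * b j) has_sum corr a b m) UNIV"
    unfolding corr_def by (intro has_sum_infsum) (simp add: mult.commute)
  moreover have "((\<lambda>j. A * norm (b j)) has_sum A * (\<Sum>\<^sub>\<infinity>j. norm (b j))) UNIV"
    by (intro has_sum_cmult_right has_sum_infsum b)
  ultimately show ?thesis
    by (rule norm_infsum_le) (auto simp: norm_mult intro!: mult_right_mono assms)
qed

lemma conv_commute: "conv a b = conv b a"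
proof
  fix n
  show "conv a b n = conv b a n" unfolding conv_def
    by (rule infsum_reindex_bij_witness[of _ "\<lambda>k. n - k" "\<lambda>k. n - k"]) auto
qed

text \<open>The substitution \<open>k = m + j + i\<close> and an exchange of sums collect the
  factors of \<open>h k\<close> into a convolution. This displays the double contraction as a linear
  functional of \<open>h\<close>, from which the \<open>w\<close>-gradient of \<open>momv m\<close>
  is read off.\<close>

lemma corr_corr_has_sum:
  assumes h: "h summable_on UNIV" and p: "p summable_on UNIV" and q: "q summable_on UNIV"
  shows "((\<lambda>k. conv p q (k - m) * h k) has_sum corr (corr h p) q m) UNIV"
proof -
  have pairs: "(\<lambda>(k, j). h k * (p (k - m - j) * q j)) summable_on (UNIV \<times> UNIV :: (int \<times> int) set)"
  proof -
    have "(\<lambda>(n, j). p (n - j) * q j) summable_on (UNIV :: (int \<times> int) set)"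
      by (rule conv_pairs_summable) fact+
    then have "(\<lambda>(k, j). p (k - m - j) * q j) summable_on (UNIV :: (int \<times> int) set)"
      by (subst summable_on_reindex_bij_witness[of UNIV "\<lambda>(n, j). (n + m, j)" "\<lambda>(k, j). (k - m, j)" UNIV
          "\<lambda>(n, j). p (n - j) * q j"]) auto
    then have "(\<lambda>x. (case x of (k, j) \<Rightarrow> p (k - m - j) * q j) * h (fst x)) summable_on UNIV"
      by (rule summable_on_mult_bounded) (rule norm_le_infsum_norm[OF h])
    then show ?thesis by (simp add: case_prod_unfold mult_ac)
  qed
  have "corr (corr h p) q m = (\<Sum>\<^sub>\<infinity>j. (\<Sum>\<^sub>\<infinity>i. h (m + j + i) * p i) * q j)"
    by (simp add: corr_def)
  also have "\<dots> = (\<Sum>\<^sub>\<infinity>j. \<Sum>\<^sub>\<infinity>k. h k * (p (k - m - j) * q j))"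
  proof (rule infsum_cong)
    fix j
    have "(\<Sum>\<^sub>\<infinity>i. h (m + j + i) * p i) = (\<Sum>\<^sub>\<infinity>k. h k * p (k - m - j))"
      by (rule infsum_reindex_bij_witness[of _ "\<lambda>k. k - m - j" "\<lambda>i. m + j + i"]) auto
    then show "(\<Sum>\<^sub>\<infinity>i. h (m + j + i) * p i) * q j = (\<Sum>\<^sub>\<infinity>k. h k * (p (k - m - j) * q j))"
      by (simp add: infsum_cmult_left' flip: mult.assoc)
  qed
  also have "\<dots> = (\<Sum>\<^sub>\<infinity>k. \<Sum>\<^sub>\<infinity>j. h k * (p (k - m - j) * q j))"
    by (rule infsum_swap_banach[symmetric]) (rule pairs)
  also have "\<dots> = (\<Sum>\<^sub>\<infinity>k. conv p q (k - m) * h k)"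
    by (simp add: infsum_cmult_right' conv_def mult.commute)
  finally have eq: "corr (corr h p) q m = (\<Sum>\<^sub>\<infinity>k. conv p q (k - m) * h k)" .
  show ?thesis unfolding eq
    by (intro has_sum_infsum summable_on_mult) (simp_all add: conv_summable assms)
qed

text \<open>The convolution in \<open>corr_corr_has_sum\<close> is commutative. This is the symmetry
  of the trilinear form behind \<open>momv\<close>.\<close>

lemma corr_corr_commute:
  assumes "h summable_on UNIV" "p summable_on UNIV" "q summable_on UNIV"
  shows "corr (corr h p) q m = corr (corr h q) p m"
  using corr_corr_has_sum[OF assms] corr_corr_has_sum[OF assms(1,3,2)]
  by (metis conv_commute has_sum_unique)

section \<open>The Hankel operator and \<open>A_op\<close> in Fourier coefficients\<close>

lemma Hankel_synth:
  assumes "a summable_on UNIV" "b summable_on UNIV"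
  shows "Hankel (synth a) (synth b) = synth (\<lambda>k. if k \<ge> 1 then corr a b k else 0)"
  using assms
  by (simp add: Hankel_def[abs_def] synth_check synth_mult proj_plus0_synth corr_summable flip: corr_eq_conv)

text \<open>After \<open>k + 1\<close> shifts the projection removes exactly the frequencies up to
  \<open>k\<close>. As \<open>a\<close> has no nonpositive frequencies, the removed part is a
  trigonometric polynomial, and what remains is the function minus this polynomial, times a
  character.\<close>

lemma proj_plus_shift_synth:
  assumes a: "a summable_on UNIV" and a0: "\<And>k. k \<le> 0 \<Longrightarrow> a k = 0"
  shows "proj_plus ((shift ^^ (k + 1)) (synth a)) y =
    cis (2 * pi * of_int (- int (k + 1)) * y) * (synth a y - (\<Sum>i=1..k. a (int i) * cis (2 * pi * of_int (int i) * y)))"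
proof -
  define e where "e j = cis (2 * pi * of_int j * y)" for j
  have e: "e (i + j) = e i * e j" for i j by (simp add: e_def cis_mult algebra_simps)
  define b where "b j = (if j \<ge> int k + 1 then a j else 0)" for j
  have b: "b summable_on UNIV" unfolding b_def by (rule summable_on_restrict[OF a])
  have "proj_plus ((shift ^^ (k + 1)) (synth a)) y = synth (\<lambda>j. b (j - (- int (k + 1)))) y"
    using a by (subst shift_synth, subst proj_plus_synth)
      (auto simp: b_def synth_def algebra_simps intro!: infsum_cong)
  also have "\<dots> = e (- int (k + 1)) * synth b y"
    using synth_cis_mult[of b y "- int (k + 1)"] by (simp add: e_def mult.commute)
  also have "synth b y = synth a y - (\<Sum>i=1..k. a (int i) * e (int i))"
  proof -
    have 1: "((\<lambda>j. a j * e j - b j * e j) has_sum (synth a y - synth b y)) UNIV"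
      unfolding synth_def e_def by (intro has_sum_diff has_sum_infsum synth_summable a b)
    have 2: "((\<lambda>j. a j * e j - b j * e j) has_sum (\<Sum>i=1..k. a (int i) * e (int i))) UNIV"
    proof (rule has_sum_finite_neutralI[of "int ` {1..k}"])
      show "(\<Sum>i=1..k. a (int i) * e (int i)) = (\<Sum>j\<in>int ` {1..k}. a j * e j - b j * e j)"
        by (subst sum.reindex) (auto simp: b_def intro!: sum.cong)
      fix j assume j: "j \<in> UNIV - int ` {1..k}"
      have "j \<le> 0 \<or> j \<ge> int k + 1"
      proof (rule ccontr)
        assume "\<not> ?thesis"
        then have "j = int (nat j)" "nat j \<in> {1..k}" by auto
        with j show False by (metis DiffD2 imageI)
      qed
      then show "a j * e j - b j * e j = 0" by (auto simp: b_def a0)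
    qed auto
    from has_sum_unique[OF 1 2] show ?thesis by (simp add: algebra_simps)
  qed
  finally show ?thesis by (simp add: e_def)
qed

text \<open>Only the two trigonometric polynomials of \<open>proj_plus_shift_synth\<close> survive
  the antisymmetrization, so the result is a finite combination of shifts of \<open>a\<close> and
  \<open>b\<close>.\<close>

lemma A_op_synth:
  assumes a: "a summable_on UNIV" and a0: "\<And>k. k \<le> 0 \<Longrightarrow> a k = 0"
    and b: "b summable_on UNIV" and b0: "\<And>k. k \<le> 0 \<Longrightarrow> b k = 0"
  shows "A_op k (synth a) (synth b) =
    synth (\<lambda>n. \<Sum>i=1..k. b (int i) * a (n + int (k + 1 - i)) - a (int i) * b (n + int (k + 1 - i)))"
proof
  fix y
  define e where "e j = cis (2 * pi * of_int j * y)" for j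
  have e: "e (i + j) = e i * e j" for i j by (simp add: e_def cis_mult algebra_simps)
  have mult: "synth c y * e j = synth (\<lambda>n. c (n - j)) y" for c j
    unfolding e_def by (rule synth_cis_mult)
  define E where "E = e (- int (k + 1))"
  have "A_op k (synth a) (synth b) y =
      synth b y * (E * (synth a y - (\<Sum>i=1..k. a (int i) * e (int i)))) -
      synth a y * (E * (synth b y - (\<Sum>i=1..k. b (int i) * e (int i))))"
    unfolding A_op_def by (subst (1 2) proj_plus_shift_synth) (simp_all only: a a0 b b0 E_def e_def)
  also have "\<dots> = (\<Sum>i=1..k. b (int i) * (synth a y * (E * e (int i)))) -
      (\<Sum>i=1..k. a (int i) * (synth b y * (E * e (int i))))"
    \<comment> \<open>The term \<open>E * synth a y * synth b y\<close> occurs in both products and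
      cancels.\<close>
    by (simp add: algebra_simps sum_distrib_left)
  also have "\<dots> = (\<Sum>i=1..k. b (int i) * synth (\<lambda>n. a (n + int (k + 1 - i))) y -
      a (int i) * synth (\<lambda>n. b (n + int (k + 1 - i))) y)"
    unfolding sum_subtractf[symmetric]
  proof (rule sum.cong)
    fix i assume "i \<in> {1..k}"
    then have "E * e (int i) = e (- int (k + 1 - i))"
      by (auto simp: E_def e[symmetric] of_nat_diff intro!: arg_cong[of _ _ e])
    then show "b (int i) * (synth a y * (E * e (int i))) - a (int i) * (synth b y * (E * e (int i))) =
        b (int i) * synth (\<lambda>n. a (n + int (k + 1 - i))) y - a (int i) * synth (\<lambda>n. b (n + int (k + 1 - i))) y"
      by (simp add: mult)
  qed simp
  also have "\<dots> = synth (\<lambda>n. \<Sum>i=1..k. b (int i) * a (n + int (k + 1 - i)) - a (int i) * b (n + int (k + 1 - i))) y"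
  proof -
    have "((\<lambda>n. \<Sum>i=1..k. b (int i) * (a (n + int (k + 1 - i)) * e n) - a (int i) * (b (n + int (k + 1 - i)) * e n)) has_sum
      (\<Sum>i=1..k. b (int i) * synth (\<lambda>n. a (n + int (k + 1 - i))) y -
      a (int i) * synth (\<lambda>n. b (n + int (k + 1 - i))) y)) UNIV"
      unfolding synth_def e_def
      by (intro has_sum_sum has_sum_diff has_sum_cmult_right has_sum_infsum synth_summable)
         (use a b in auto)
    then show ?thesis
      unfolding synth_def[of "\<lambda>n. \<Sum>i=1..k. _ i n"] e_def
      by (intro infsumI[symmetric]) (simp add: sum_distrib_right left_diff_distrib mult.assoc)
  qed
  finally show "A_op k (synth a) (synth b) y = \<dots>" .
qed

text \<open>Pairing a sequence shifted by \<open>k + 1 - i\<close> with \<open>p\<close> is its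
  correlation with \<open>p\<close> at \<open>k + 1 - i\<close>; the finite sum of
  \<open>A_op_synth\<close> is paired term by term.\<close>

lemma pairing_A_op:
  assumes a: "a summable_on UNIV" and a0: "\<And>k. k \<le> 0 \<Longrightarrow> a k = 0"
    and b: "b summable_on UNIV" and b0: "\<And>k. k \<le> 0 \<Longrightarrow> b k = 0"
    and p: "p summable_on UNIV"
  shows "pairing (A_op k (synth a) (synth b)) (synth p) =
    (\<Sum>i=1..k. b (int i) * corr a p (int (k + 1 - i)) - a (int i) * corr b p (int (k + 1 - i)))"
proof -
  have s: "(\<lambda>n. \<Sum>i=1..k. b (int i) * a (n + int (k + 1 - i)) - a (int i) * b (n + int (k + 1 - i))) summable_on UNIV"
    by (rule has_sum_imp_summable[OF has_sum_sum[OF has_sum_diff[OF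
            has_sum_cmult_right[OF has_sum_infsum] has_sum_cmult_right[OF has_sum_infsum]]]])
       (use a b in auto)
  have "((\<lambda>n. \<Sum>i=1..k. b (int i) * (a (int (k + 1 - i) + n) * p n) - a (int i) * (b (int (k + 1 - i) + n) * p n)) has_sum
    (\<Sum>i=1..k. b (int i) * corr a p (int (k + 1 - i)) - a (int i) * corr b p (int (k + 1 - i)))) UNIV"
    by (intro has_sum_sum has_sum_diff has_sum_cmult_right corr_has_sum a b p)
  moreover have "A_op k (synth a) (synth b) =
      synth (\<lambda>n. \<Sum>i=1..k. b (int i) * a (n + int (k + 1 - i)) - a (int i) * b (n + int (k + 1 - i)))"
    by (rule A_op_synth) (fact a a0 b b0)+
  ultimately show ?thesis
    unfolding pairing_def coeff_pairing_def fcoeff_synth[OF p]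
    by (intro infsumI) (simp add: sum_distrib_right left_diff_distrib mult.assoc add.commute fcoeff_synth[OF s, simplified])
qed

section \<open>Fourier coefficients of elements of \<open>hplus0\<close>\<close>

definition fc :: "hplus0 \<Rightarrow> int \<Rightarrow> complex"
  where "fc f = fcoeff (fn f)"

lemma fn_H1: "continuous_on UNIV (fn f)" "fn f (y + 1) = fn f y"
    "(\<lambda>k. (cmod (fc f k))\<^sup>2 * (jbracket k)\<^sup>2) summable_on UNIV"
  using fn[of f] by (auto simp: H1_plus0_def H1_def fc_def)

lemma fc_nonpos [simp]: "k \<le> 0 \<Longrightarrow> fc f k = 0"
  using fn[of f] by (auto simp: H1_plus0_def fc_def)

lemma fc_add: "fc (f + g) k = fc f k + fc g k"
  by (simp add: fc_def plus_hplus0.rep_eq fcoeff_add fn_H1)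

lemma fc_scaleC: "fc (c *\<^sub>C f) k = c * fc f k"
  by (simp add: fc_def scaleC_hplus0.rep_eq fcoeff_cmult)

lemma fc_scaleR: "fc (c *\<^sub>R f) k = c *\<^sub>R fc f k"
  by (simp add: scaleR_hplus0_def fc_scaleC scaleR_conv_of_real)

text \<open>The l2 norm of the weights \<open>1/k\<close>, which bounds the embedding of
  \<open>hplus0\<close> into the l1 sequences.\<close>

definition l1_const :: real
  where "l1_const = sqrt (\<Sum>\<^sub>\<infinity>k\<in>{1::int..}. inverse ((real_of_int k)\<^sup>2))"

text \<open>Cauchy-Schwarz on the positive frequencies, after splitting each coefficient into its
  weighted modulus and the weight \<open>1/k\<close>. Uniformity in the finite set \<open>F\<close>
  then gives summability.\<close>

lemma sum_norm_fc_le: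
  assumes "finite F"
  shows "(\<Sum>k\<in>F. norm (fc f k)) \<le> l1_const * norm f"
proof -
  have inv: "(\<lambda>k. inverse ((real_of_int k)\<^sup>2)) summable_on {1..}"
  proof -
    have "summable (\<lambda>n. inverse ((real n)\<^sup>2))"
      using inverse_power_summable[of 2, where 'a = real] by simp
    then have "(\<lambda>n. inverse ((real n)\<^sup>2)) summable_on UNIV"
      by (intro summable_nonneg_imp_summable_on) auto
    then have "(\<lambda>n. inverse ((real n)\<^sup>2)) summable_on {1..}"
      by (rule summable_on_subset) auto
    then show ?thesis
      by (subst summable_on_reindex_bij_witness[of _ int nat "{1..}" "\<lambda>n. inverse ((real n)\<^sup>2)"]) auto
  qed
  let ?F = "F \<inter> {1..}"
  have "(\<Sum>k\<in>F. norm (fc f k)) = (\<Sum>k\<in>?F. norm (fc f k))"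
    using assms by (intro sum.mono_neutral_right) (auto, meson fc_nonpos not_le int_one_le_iff_zero_less)
  also have "\<dots> = (\<Sum>k\<in>?F. \<bar>norm (fc f k) * jbracket k\<bar> * \<bar>inverse (real_of_int k)\<bar>)"
    by (intro sum.cong) (auto simp: jbracket_def abs_mult)
  also have "\<dots> \<le> L2_set (\<lambda>k. norm (fc f k) * jbracket k) ?F * L2_set (\<lambda>k. inverse (real_of_int k)) ?F"
    by (rule L2_set_mult_ineq)
  also have "\<dots> \<le> norm f * l1_const"
  proof (rule mult_mono)
    show "L2_set (\<lambda>k. norm (fc f k) * jbracket k) ?F \<le> norm f"
      unfolding L2_set_def norm_hplus0.rep_eq H1_norm_def power_mult_distrib
      using fn_H1(3)[of f] assms unfolding fc_def[symmetric]
      by (intro real_sqrt_le_mono finite_sum_le_infsum) auto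
    show "L2_set (\<lambda>k. inverse (real_of_int k)) ?F \<le> l1_const"
      unfolding L2_set_def l1_const_def power_inverse
      using inv assms by (intro real_sqrt_le_mono finite_sum_le_infsum) (auto simp: power_inverse)
  qed (auto simp: L2_set_def sum_nonneg)
  finally show ?thesis by (simp add: mult.commute)
qed

lemma fc_summable [simp]: "fc f summable_on UNIV"
proof -
  have "(\<lambda>k. norm (fc f k)) summable_on UNIV"
    by (rule nonneg_bdd_above_summable_on)
       (auto intro!: bdd_aboveI2[where M = "l1_const * norm f"] sum_norm_fc_le)
  then show ?thesis by (simp add: summable_on_iff_abs_summable_on_complex)
qed

lemma infsum_norm_fc_le: "(\<Sum>\<^sub>\<infinity>k. norm (fc f k)) \<le> l1_const * norm f"
  by (rule infsum_le_finite_sums)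
     (auto intro: sum_norm_fc_le simp flip: summable_on_iff_abs_summable_on_complex)

lemma norm_fc_le: "norm (fc f k) \<le> l1_const * norm f"
  using sum_norm_fc_le[of "{k}" f] by simp

lemma fn_eq_synth: "fn f = synth (fc f)"
  unfolding fc_def by (rule synth_fcoeff[symmetric]) (use fn_H1 fc_summable in \<open>auto simp: fc_def\<close>)

text \<open>The characters of positive frequency are test vectors that isolate a single coefficient
  of a gradient.\<close>

lemma exists_fc_delta:
  assumes "k \<ge> 1"
  shows "\<exists>f. fc f = (\<lambda>j. if j = k then 1 else 0)"
proof -
  let ?d = "\<lambda>j. if j = k then 1 else 0 :: complex"
  have s: "?d summable_on UNIV"
    by (rule finite_nonzero_values_imp_summable_on) (auto intro: finite_subset[of _ "{k}"])
  have f: "fcoeff (synth ?d) = ?d" by (rule ext) (rule fcoeff_synth[OF s])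
  have "(\<lambda>j. (cmod (?d j))\<^sup>2 * (jbracket j)\<^sup>2) summable_on UNIV"
    by (rule finite_nonzero_values_imp_summable_on) (auto intro: finite_subset[of _ "{k}"])
  then have "synth ?d \<in> H1_plus0"
    using assms by (auto simp: H1_plus0_def H1_def f continuous_on_synth s synth_periodic)
  then have "fc (Abs_hplus0 (synth ?d)) = ?d" by (simp add: fc_def Abs_hplus0_inverse f)
  then show ?thesis by blast
qed

section \<open>The moments, and \<open>Ham\<close> and \<open>I_fun\<close> in terms of them\<close>

definition momw :: "int \<Rightarrow> phase_space \<Rightarrow> complex"
  where "momw m z = fc (fst z) m"

definition momu :: "int \<Rightarrow> phase_space \<Rightarrow> complex"
  where "momu m z = corr (fc (fst z)) (fc (snd z)) m"

definition momv :: "int \<Rightarrow> phase_space \<Rightarrow> complex"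
  where "momv m z = corr (corr (fc (fst z)) (fc (snd z))) (fc (snd z)) m"

text \<open>The coefficients of the square of \<open>p\<close> form the convolution of its
  coefficients with themselves; \<open>corr_corr_has_sum\<close> at shift 0 turns the pairing into a
  double contraction.\<close>

lemma Ham_eq: "Ham = momv 0"
proof
  fix z :: phase_space
  have "Ham z = (\<Sum>\<^sub>\<infinity>k. fc (fst z) k * conv (fc (snd z)) (fc (snd z)) k)"
    by (simp add: Ham_def Let_def pairing_def coeff_pairing_def fn_eq_synth power2_eq_square synth_mult
        fcoeff_synth conv_summable)
  also have "\<dots> = momv 0 z"
    using corr_corr_has_sum[of "fc (fst z)" "fc (snd z)" "fc (snd z)" 0]
    by (simp add: momv_def infsumI mult.commute)
  finally show "Ham z = momv 0 z" .
qed

text \<open>The Hankel operator produces the positive part \<open>b\<close> of the moments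
  \<open>momu\<close>, and one more contraction of \<open>b\<close> with \<open>p\<close> produces
  \<open>momv\<close>.\<close>

lemma I_fun_eq:
  "I_fun k z = (\<Sum>i=1..k. momu (int i) z * momu (int (k + 1 - i)) z - momw (int i) z * momv (int (k + 1 - i)) z)"
proof -
  define a where "a = fc (fst z)"
  define p where "p = fc (snd z)"
  define b where "b k = (if k \<ge> 1 then corr a p k else 0)" for k
  have a: "a summable_on UNIV" and p: "p summable_on UNIV" by (simp_all add: a_def p_def)
  have b: "b summable_on UNIV" unfolding b_def by (intro summable_on_restrict corr_summable a p)
  \<comment> \<open>The truncation in \<open>b\<close> is invisible here: a nonzero
    \<open>p j\<close> forces \<open>j \<ge> 1\<close>, hence \<open>m + j \<ge> 1\<close>.\<close>
  have bp: "corr b p m = momv m z" if "m \<ge> 0" for m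
    unfolding corr_def momv_def
    by (rule infsum_cong) (use that in \<open>auto simp: b_def p_def a_def corr_def\<close>)
  have "I_fun k z = pairing (A_op k (synth a) (Hankel (synth a) (synth p))) (synth p)"
    by (simp add: I_fun_def Let_def fn_eq_synth a_def p_def)
  also have "Hankel (synth a) (synth p) = synth b"
    unfolding Hankel_synth[OF a p] b_def ..
  also have "pairing (A_op k (synth a) (synth b)) (synth p) =
      (\<Sum>i=1..k. b (int i) * corr a p (int (k + 1 - i)) - a (int i) * corr b p (int (k + 1 - i)))"
    by (rule pairing_A_op) (auto simp: a b p b_def a_def)
  also have "\<dots> = (\<Sum>i=1..k. momu (int i) z * momu (int (k + 1 - i)) z - momw (int i) z * momv (int (k + 1 - i)) z)"
    by (rule sum.cong) (auto simp: bp, auto simp: b_def a_def p_def momu_def momw_def)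
  finally show ?thesis .
qed


section \<open>Polynomial maps on complex normed spaces\<close>

text \<open>All functions involved are polynomial. Asking for a finite expansion makes the convergence
  condition of analyticity trivial and keeps the class closed under products.\<close>

definition polynomial_at :: "('a::complex_normed_vector \<Rightarrow> complex) \<Rightarrow> 'a \<Rightarrow> bool"
  where "polynomial_at f x \<longleftrightarrow> (\<exists>a M N. (\<forall>n. multilinear_bound n (a n) (M n)) \<and>
    (\<forall>n\<ge>N. \<forall>v. a n v = 0) \<and> (\<forall>h. (\<lambda>n. a n (\<lambda>_. h)) sums f (x + h)))"

lemma polynomial_at_analytic:
  assumes "\<And>x. polynomial_at f x"
  shows "complex_analytic_on f UNIV"
  unfolding complex_analytic_on_def
proof (intro conjI ballI)
  fix x
  obtain a M N where a: "\<And>n. multilinear_bound n (a n) (M n)" "\<And>n v. n \<ge> N \<Longrightarrow> a n v = 0"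
    "\<And>h. (\<lambda>n. a n (\<lambda>_. h)) sums f (x + h)"
    using assms[of x] unfolding polynomial_at_def by metis
  \<comment> \<open>From degree \<open>N\<close> on the forms vanish, so 0 is an admissible bound
    and the majorant series is finite for every radius; 1 is taken.\<close>
  define M' where "M' n = (if n < N then M n else 0)" for n
  have "multilinear_bound n (a n) (M' n)" for n
    using a(1)[of n] a(2)[of n] by (auto simp: multilinear_bound_def M'_def)
  moreover have "summable (\<lambda>n. M' n * 1 ^ n)"
    by (rule summable_finite[of "{..<N}"]) (auto simp: M'_def)
  ultimately show "\<exists>r>0. \<exists>a M. ball x r \<subseteq> UNIV \<and> (\<forall>n. multilinear_bound n (a n) (M n)) \<and>
       summable (\<lambda>n. M n * r ^ n) \<and> (\<forall>h. norm h < r \<longrightarrow> (\<lambda>n. a n (\<lambda>_. h)) sums f (x + h))"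
    using a(3) by (intro exI[of _ 1] exI[of _ a] exI[of _ M'] conjI) auto
qed simp

lemma polynomial_atI:
  assumes "\<And>n. multilinear_bound n (a n) (M n)" "\<And>n v. n \<ge> N \<Longrightarrow> a n v = 0"
    "\<And>h. f (x + h) = (\<Sum>n<N. a n (\<lambda>_. h))"
  shows "polynomial_at f x"
  unfolding polynomial_at_def
proof (intro exI[of _ a] exI[of _ M] exI[of _ N] conjI allI impI assms(1,2))
  show "(\<lambda>n. a n (\<lambda>_. h)) sums f (x + h)" for h
    using sums_finite[of "{..<N}" "\<lambda>n. a n (\<lambda>_. h)"] assms(2,3) by (simp add: not_less)
qed

lemma polynomial_at_const: "polynomial_at (\<lambda>_. c) x"
  by (rule polynomial_atI[where a = "\<lambda>n _. if n = 0 then c else 0" and N = 1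
      and M = "\<lambda>n. if n = 0 then norm c else 0"])
     (auto simp: multilinear_bound_def scaleC_complex_def)

lemma polynomial_at_add:
  assumes "polynomial_at f x" "polynomial_at g x"
  shows "polynomial_at (\<lambda>x. f x + g x) x"
proof -
  obtain a M N where a: "\<And>n. multilinear_bound n (a n) (M n)" "\<And>n v. n \<ge> N \<Longrightarrow> a n v = 0"
    "\<And>h. (\<lambda>n. a n (\<lambda>_. h)) sums f (x + h)"
    using assms(1) unfolding polynomial_at_def by metis
  obtain b M' N' where b: "\<And>n. multilinear_bound n (b n) (M' n)" "\<And>n v. n \<ge> N' \<Longrightarrow> b n v = 0"
    "\<And>h. (\<lambda>n. b n (\<lambda>_. h)) sums g (x + h)"
    using assms(2) unfolding polynomial_at_def by metis
  have "multilinear_bound n (\<lambda>v. a n v + b n v) (M n + M' n)" for n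
    unfolding multilinear_bound_def
  proof (intro conjI allI impI)
    fix u v :: "nat \<Rightarrow> 'a" assume uv: "\<forall>i<n. u i = v i"
    have "a n u = a n v" "b n u = b n v"
      using a(1)[of n] b(1)[of n] uv unfolding multilinear_bound_def by blast+
    then show "a n u + b n u = a n v + b n v" by simp
  next
    fix v :: "nat \<Rightarrow> 'a" and i c y z assume "i < n"
    with a(1)[of n] b(1)[of n]
    show "a n (v(i := y + c *\<^sub>C z)) + b n (v(i := y + c *\<^sub>C z)) =
        a n (v(i := y)) + b n (v(i := y)) + c *\<^sub>C (a n (v(i := z)) + b n (v(i := z)))"
      by (simp add: multilinear_bound_def scaleC_complex_def algebra_simps)
  next
    fix v
    have "norm (a n v) \<le> M n * (\<Prod>i<n. norm (v i))" "norm (b n v) \<le> M' n * (\<Prod>i<n. norm (v i))"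
      using a(1)[of n] b(1)[of n] unfolding multilinear_bound_def by blast+
    then show "norm (a n v + b n v) \<le> (M n + M' n) * (\<Prod>i<n. norm (v i))"
      unfolding distrib_right by (rule norm_triangle_mono)
  qed
  moreover have "\<forall>n\<ge>max N N'. \<forall>v. a n v + b n v = 0" using a(2) b(2) by simp
  moreover have "(\<lambda>n. a n (\<lambda>_. h) + b n (\<lambda>_. h)) sums (f (x + h) + g (x + h))" for h
    by (intro sums_add a b)
  ultimately show ?thesis unfolding polynomial_at_def
    by (intro exI[of _ "\<lambda>n v. a n v + b n v"] exI[of _ "\<lambda>n. M n + M' n"] exI[of _ "max N N'"]) blast
qed

lemma prod_lessThan_add:
  fixes g :: "nat \<Rightarrow> 'a::comm_monoid_mult"
  shows "(\<Prod>j<i + m. g j) = (\<Prod>j<i. g j) * (\<Prod>j<m. g (i + j))"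
  by (induction m) (auto simp: mult.assoc)

text \<open>Cauchy product of the two expansions. Both are finite, hence absolutely convergent, and
  every product of total degree at least \<open>N + N'\<close> has a vanishing factor.\<close>

lemma polynomial_at_mult:
  assumes "polynomial_at f x" "polynomial_at g x"
  shows "polynomial_at (\<lambda>x. f x * g x) x"
proof -
  obtain a M N where a: "\<And>n. multilinear_bound n (a n) (M n)" "\<And>n v. n \<ge> N \<Longrightarrow> a n v = 0"
    "\<And>h. (\<lambda>n. a n (\<lambda>_. h)) sums f (x + h)"
    using assms(1) unfolding polynomial_at_def by metis
  obtain b M' N' where b: "\<And>n. multilinear_bound n (b n) (M' n)" "\<And>n v. n \<ge> N' \<Longrightarrow> b n v = 0"
    "\<And>h. (\<lambda>n. b n (\<lambda>_. h)) sums g (x + h)"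
    using assms(2) unfolding polynomial_at_def by metis
  have a_cong: "a n u = a n v" if "\<And>i. i < n \<Longrightarrow> u i = v i" for n u v
    using a(1)[of n] that unfolding multilinear_bound_def by blast
  have b_cong: "b n u = b n v" if "\<And>i. i < n \<Longrightarrow> u i = v i" for n u v
    using b(1)[of n] that unfolding multilinear_bound_def by blast
  have a_lin: "a n (v(i := y + c *\<^sub>C z)) = a n (v(i := y)) + c * a n (v(i := z))" if "i < n" for n v i y c z
    using a(1)[of n] that unfolding multilinear_bound_def scaleC_complex_def by blast
  have b_lin: "b n (v(i := y + c *\<^sub>C z)) = b n (v(i := y)) + c * b n (v(i := z))" if "i < n" for n v i y c z
    using b(1)[of n] that unfolding multilinear_bound_def scaleC_complex_def by blast
  \<comment> \<open>The first \<open>i\<close> arguments go to \<open>a i\<close>, the remaining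
    \<open>n - i\<close> to \<open>b (n - i)\<close>; no symmetrization is made.\<close>
  define t where "t n i v = a i v * b (n - i) (\<lambda>j. v (i + j))" for n i v
  have "multilinear_bound n (\<lambda>v. \<Sum>i\<le>n. t n i v) (\<Sum>i\<le>n. M i * M' (n - i))" for n
    unfolding multilinear_bound_def
  proof (intro conjI allI impI)
    fix u v :: "nat \<Rightarrow> 'a" assume uv: "\<forall>i<n. u i = v i"
    have "t n i u = t n i v" if "i \<le> n" for i
      unfolding t_def using uv that by (intro arg_cong2[where f = "(*)"] a_cong b_cong) auto
    then show "(\<Sum>i\<le>n. t n i u) = (\<Sum>i\<le>n. t n i v)" by simp
  next
    fix v :: "nat \<Rightarrow> 'a" and k c y z assume k: "k < n"
    have "t n i (v(k := y + c *\<^sub>C z)) = t n i (v(k := y)) + c * t n i (v(k := z))" if "i \<le> n" for i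
    \<comment> \<open>Slot \<open>k\<close> belongs to exactly one factor: to the first if
      \<open>k < i\<close>, and otherwise it is slot \<open>k - i\<close> of the second.\<close>
    proof (cases "k < i")
      case True
      then have "(\<lambda>j. (v(k := s)) (i + j)) = (\<lambda>j. v (i + j))" for s by auto
      then show ?thesis using a_lin[OF True] by (simp add: t_def algebra_simps)
    next
      case False
      then have 1: "(\<lambda>j. (v(k := s)) (i + j)) = (\<lambda>j. v (i + j))(k - i := s)" for s by (auto simp: fun_eq_iff)
      have 2: "a i (v(k := s)) = a i v" for s using False by (intro a_cong) auto
      have "k - i < n - i" using k False by auto
      from b_lin[OF this] show ?thesis unfolding t_def 1 2 by (simp add: algebra_simps)
    qed
    then show "(\<Sum>i\<le>n. t n i (v(k := y + c *\<^sub>C z))) =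
        (\<Sum>i\<le>n. t n i (v(k := y))) + c *\<^sub>C (\<Sum>i\<le>n. t n i (v(k := z)))"
      by (simp add: scaleC_complex_def sum.distrib sum_distrib_left)
  next
    fix v
    have "norm (t n i v) \<le> M i * M' (n - i) * (\<Prod>i<n. norm (v i))" if "i \<le> n" for i
    proof -
      have 1: "norm (a i v) \<le> M i * (\<Prod>j<i. norm (v j))"
        using a(1)[of i] unfolding multilinear_bound_def by blast
      have 2: "norm (b (n - i) (\<lambda>j. v (i + j))) \<le> M' (n - i) * (\<Prod>j<n - i. norm (v (i + j)))"
        using b(1)[of "n - i"] unfolding multilinear_bound_def by blast
      have "norm (t n i v) \<le> (M i * (\<Prod>j<i. norm (v j))) * (M' (n - i) * (\<Prod>j<n - i. norm (v (i + j))))"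
        \<comment> \<open>The bound on the first factor is nonnegative because it dominates a norm;
          nothing is assumed about the sign of \<open>M i\<close>.\<close>
        unfolding t_def norm_mult using 1 2 order_trans[OF norm_ge_zero 1] by (intro mult_mono) auto
      also have "\<dots> = M i * M' (n - i) * (\<Prod>j<n. norm (v j))"
        using prod_lessThan_add[of "\<lambda>j. norm (v j)" i "n - i"] that by simp
      finally show ?thesis .
    qed
    then show "norm (\<Sum>i\<le>n. t n i v) \<le> (\<Sum>i\<le>n. M i * M' (n - i)) * (\<Prod>i<n. norm (v i))"
      unfolding sum_distrib_right by (intro sum_norm_le) auto
  qed
  moreover have "\<forall>n\<ge>N + N'. \<forall>v. (\<Sum>i\<le>n. t n i v) = 0"
  proof (intro allI impI sum.neutral ballI)
    fix n v i assume "n \<ge> N + N'" "i \<in> {..n}"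
    then have "i \<ge> N \<or> n - i \<ge> N'" by auto
    then show "t n i v = 0" using a(2) b(2) by (auto simp: t_def)
  qed
  moreover have "(\<lambda>n. \<Sum>i\<le>n. t n i (\<lambda>_. h)) sums (f (x + h) * g (x + h))" for h
  proof -
    have "summable (\<lambda>n. norm (a n (\<lambda>_. h)))" "summable (\<lambda>n. norm (b n (\<lambda>_. h)))"
      by (rule summable_finite[of "{..<N}"]; simp add: a(2)) (rule summable_finite[of "{..<N'}"]; simp add: b(2))
    from Cauchy_product_sums[OF this] show ?thesis
      using a(3)[of h] b(3)[of h] by (simp add: t_def sums_iff)
  qed
  ultimately show ?thesis unfolding polynomial_at_def
    by (intro exI[of _ "\<lambda>n v. \<Sum>i\<le>n. t n i v"] exI[of _ "\<lambda>n. \<Sum>i\<le>n. M i * M' (n - i)"] exI[of _ "N + N'"]) blast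
qed

section \<open>Linear, bilinear and trilinear maps as polynomial and \<open>C1\<close>
  functions\<close>

lemma less_2_iff_cases: "i < (2::nat) \<longleftrightarrow> i = 0 \<or> i = 1" by auto
lemma less_3_iff_cases: "i < (3::nat) \<longleftrightarrow> i = 0 \<or> i = 1 \<or> i = 2" by auto

lemma norm_fst_snd_le: "norm (fst z) \<le> norm z" "norm (snd z) \<le> norm z"
  by (metis norm_fst_le prod.collapse, metis norm_snd_le prod.collapse)

lemma scaleC_1 [simp]: "1 *\<^sub>C h = (h :: 'a::complex_normed_vector)"
  using scaleC_of_real[of 1 h] by simp

lemma polynomial_at_linear:
  fixes L :: "'a::complex_normed_vector \<Rightarrow> complex"
  assumes "\<And>x c y. L (x + c *\<^sub>C y) = L x + c * L y" "\<And>x. norm (L x) \<le> K * norm x"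
  shows "polynomial_at L x"
proof (rule polynomial_atI[where N = 2])
  show "multilinear_bound n (\<lambda>v. if n = 0 then L x else if n = 1 then L (v 0) else 0)
     (if n = 0 then norm (L x) else if n = 1 then K else 0)" for n
    using assms by (auto simp: multilinear_bound_def scaleC_complex_def)
  show "L (x + h) = (\<Sum>n<2::nat. if n = 0 then L x else if n = 1 then L h else 0)" for h
    using assms(1)[of x 1 h] by (simp add: numeral_2_eq_2)
qed simp

text \<open>Each \<open>lin\<close> axiom combines additivity and homogeneity: \<open>c = 1\<close>
  gives additivity, this gives the value 0 at 0, and then homogeneity follows. The constant
  \<open>K\<close> is explicit because it enters the bounds of
  \<open>multilinear_bound\<close>.\<close>

locale bilinear_form =
  fixes B :: "'a::complex_normed_vector \<Rightarrow> 'b::complex_normed_vector \<Rightarrow> complex" and K :: real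
  assumes lin1: "B (x + c *\<^sub>C x') y = B x y + c * B x' y"
    and lin2: "B x (y + c *\<^sub>C y') = B x y + c * B x y'"
    and bound: "norm (B x y) \<le> K * norm x * norm y"
    and K: "K \<ge> 0"
begin

lemma add1: "B (x + x') y = B x y + B x' y" using lin1[of x 1 x' y] by simp
lemma add2: "B x (y + y') = B x y + B x y'" using lin2[of x y 1 y'] by simp
lemma zero1: "B 0 y = 0" using add1[of 0 0 y] by simp
lemma zero2: "B x 0 = 0" using add2[of x 0 0] by simp
lemma scale1: "B (c *\<^sub>C x) y = c * B x y" using lin1[of 0 c x y] by (simp add: zero1)
lemma scale2: "B x (c *\<^sub>C y) = c * B x y" using lin2[of x 0 c y] by (simp add: zero2)

sublocale bounded_bilinear B
proof
  show "B (a + a') b = B a b + B a' b" for a a' b by (rule add1)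
  show "B a (b + b') = B a b + B a b'" for a b b' by (rule add2)
  show "B (r *\<^sub>R a) b = r *\<^sub>R B a b" for r a b
    by (simp add: scale1 scaleR_conv_of_real flip: scaleC_of_real)
  show "B a (r *\<^sub>R b) = r *\<^sub>R B a b" for r a b
    by (simp add: scale2 scaleR_conv_of_real flip: scaleC_of_real)
  show "\<exists>K. \<forall>a b. norm (B a b) \<le> norm a * norm b * K"
    using bound by (intro exI[of _ K]) (simp add: mult_ac)
qed

lemma polynomial_at_bilinear: "polynomial_at (\<lambda>z. B (fst z) (snd z)) z"
proof (rule polynomial_atI[where N = 3])
  \<comment> \<open>The parts of degree 0, 1 and 2 in the increment of the bilinear form. The
    quadratic part feeds its two slots from different arguments, so that it is linear in each of
    them.\<close>
  let ?a = "\<lambda>n v. if n = 0 then B (fst z) (snd z)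
    else if n = 1 then B (fst (v 0)) (snd z) + B (fst z) (snd (v 0))
    else if n = 2 then B (fst (v 0)) (snd (v 1)) else 0"
  let ?M = "\<lambda>n :: nat. if n = 0 then norm (B (fst z) (snd z)) else if n = 1 then K * norm (snd z) + K * norm (fst z)
    else if n = 2 then K else 0"
  show "multilinear_bound n (?a n) (?M n)" for n
    unfolding multilinear_bound_def
  proof (intro conjI allI impI)
    show "?a n u = ?a n v" if "\<forall>i<n. u i = v i" for u v using that by simp
    show "?a n (v(i := x + c *\<^sub>C y)) = ?a n (v(i := x)) + c *\<^sub>C ?a n (v(i := y))" if "i < n" for v i c x y
      using that by (auto simp: less_2_iff_cases scaleC_prod_def scaleC_complex_def add1 add2 scale1 scale2 algebra_simps)
    fix v :: "nat \<Rightarrow> 'a \<times> 'b"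
    have "norm (B (fst (v 0)) (snd z) + B (fst z) (snd (v 0))) \<le> K * norm (v 0) * norm (snd z) + K * norm (fst z) * norm (v 0)"
      by (intro norm_triangle_mono order_trans[OF bound] mult_mono) (auto simp: K norm_fst_snd_le)
    moreover have "norm (B (fst (v 0)) (snd (v 1))) \<le> K * norm (v 0) * norm (v 1)"
      by (intro order_trans[OF bound] mult_mono) (auto simp: K norm_fst_snd_le)
    ultimately show "norm (?a n v) \<le> ?M n * (\<Prod>i<n. norm (v i))"
      by (auto simp: numeral_2_eq_2 algebra_simps)
  qed
  show "B (fst (z + h)) (snd (z + h)) = (\<Sum>n<3::nat. ?a n (\<lambda>_. h))" for h
    by (simp add: numeral_3_eq_3 add1 add2)
qed simp

lemma complex_C1_bilinear: "complex_C1 (\<lambda>z. B (fst z) (snd z))"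
  unfolding complex_C1_def
proof (intro exI conjI allI)
  let ?F = "\<lambda>z. (prod_left (snd z) o\<^sub>L fst_blinfun) + (prod_right (fst z) o\<^sub>L snd_blinfun)"
  show "continuous_on UNIV ?F"
    by (intro continuous_intros bounded_bilinear.continuous_on[OF bounded_bilinear_blinfun_compose]
          bounded_linear.continuous_on[OF bounded_linear_prod_left] bounded_linear.continuous_on[OF bounded_linear_prod_right])
  show "((\<lambda>z. B (fst z) (snd z)) has_derivative ?F z) (at z)" for z
    by (rule has_derivative_eq_rhs, rule FDERIV) 
       (auto intro!: derivative_eq_intros simp: blinfun.bilinear_simps prod_left.rep_eq prod_right.rep_eq)
  show "?F z (c *\<^sub>C v) = c * ?F z v" for z c v
    by (simp add: blinfun.bilinear_simps prod_left.rep_eq prod_right.rep_eq scaleC_prod_def scale1 scale2 algebra_simps)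
qed

end

text \<open>Symmetry in the last two slots transfers linearity from the second slot to the third,
  and merges the two terms of the derivative in the second variable into one with factor 2.\<close>

locale trilinear_form =
  fixes T :: "'a::complex_normed_vector \<Rightarrow> 'b::complex_normed_vector \<Rightarrow> 'b \<Rightarrow> complex" and K :: real
  assumes lin1: "T (x + c *\<^sub>C x') y z = T x y z + c * T x' y z"
    and lin2: "T x (y + c *\<^sub>C y') z = T x y z + c * T x y' z"
    and sym: "T x y z = T x z y"
    and bound: "norm (T x y z) \<le> K * norm x * norm y * norm z"
    and K: "K \<ge> 0"
begin

lemma lin3: "T x y (z + c *\<^sub>C z') = T x y z + c * T x y z'"
  using lin2[of x z c z' y] by (simp add: sym[of x y])
lemma add1: "T (x + x') y z = T x y z + T x' y z" using lin1[of x 1 x' y z] by simp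
lemma add2: "T x (y + y') z = T x y z + T x y' z" using lin2[of x y 1 y' z] by simp
lemma add3: "T x y (z + z') = T x y z + T x y z'" using lin3[of x y z 1 z'] by simp
lemma zero1: "T 0 y z = 0" using add1[of 0 0 y z] by simp
lemma zero2: "T x 0 z = 0" using add2[of x 0 0 z] by simp
lemma zero3: "T x y 0 = 0" using add3[of x y 0 0] by simp
lemma scale1: "T (c *\<^sub>C x) y z = c * T x y z" using lin1[of 0 c x y z] by (simp add: zero1)
lemma scale2: "T x (c *\<^sub>C y) z = c * T x y z" using lin2[of x 0 c y z] by (simp add: zero2)
lemma scale3: "T x y (c *\<^sub>C z) = c * T x y z" using lin3[of x y 0 c z] by (simp add: zero3)

lemma scaleR:
  "T (r *\<^sub>R x) y z = r *\<^sub>R T x y z" "T x (r *\<^sub>R y) z = r *\<^sub>R T x y z" "T x y (r *\<^sub>R z) = r *\<^sub>R T x y z"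
  by (simp_all add: scale1 scale2 scale3 scaleR_conv_of_real flip: scaleC_of_real)

lemma polynomial_at_trilinear: "polynomial_at (\<lambda>z. T (fst z) (snd z) (snd z)) z"
proof (rule polynomial_atI[where N = 4])
  define w where "w = fst z"
  define p where "p = snd z"
  define A where "A = K * norm w * norm p"
  define A' where "A' = K * norm p * norm p"
  \<comment> \<open>The linear and quadratic parts of the expansion of \<open>T\<close> at
    \<open>(w, p, p)\<close>, before any use of symmetry.\<close>
  let ?a1 = "\<lambda>x. T (fst x) p p + T w (snd x) p + T w p (snd x)"
  let ?a2 = "\<lambda>x y. T (fst x) (snd y) p + T (fst x) p (snd y) + T w (snd x) (snd y)"
  let ?a = "\<lambda>n v. if n = 0 then T w p p else if n = 1 then ?a1 (v 0)
    else if n = 2 then ?a2 (v 0) (v 1) else if n = 3 then T (fst (v 0)) (snd (v 1)) (snd (v 2)) else 0"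
  let ?M = "\<lambda>n :: nat. if n = 0 then norm (T w p p) else if n = 1 then A' + A + A
    else if n = 2 then K * norm p + K * norm p + K * norm w else if n = 3 then K else 0"
  show "multilinear_bound n (?a n) (?M n)" for n
    unfolding multilinear_bound_def
  proof (intro conjI allI impI)
    show "?a n u = ?a n v" if "\<forall>i<n. u i = v i" for u v using that by simp
    show "?a n (v(i := x + c *\<^sub>C y)) = ?a n (v(i := x)) + c *\<^sub>C ?a n (v(i := y))" if "i < n" for v i c x y
      using that by (auto simp: less_2_iff_cases less_3_iff_cases scaleC_prod_def scaleC_complex_def
          add1 add2 add3 scale1 scale2 scale3 algebra_simps)
    fix v :: "nat \<Rightarrow> 'a \<times> 'b"
    have "norm (?a1 x) \<le> K * norm x * norm p * norm p + K * norm w * norm x * norm p + K * norm w * norm p * norm x" for x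
      by (intro norm_triangle_mono order_trans[OF bound] mult_mono) (auto simp: K norm_fst_snd_le)
    from this[of "v 0"] have 1: "norm (?a1 (v 0)) \<le> (A' + A + A) * norm (v 0)"
      by (simp add: A_def A'_def algebra_simps)
    have "norm (?a2 x y) \<le> K * norm x * norm y * norm p + K * norm x * norm p * norm y + K * norm w * norm x * norm y" for x y
      by (intro norm_triangle_mono order_trans[OF bound] mult_mono) (auto simp: K norm_fst_snd_le)
    from this[of "v 0" "v 1"] have 2: "norm (?a2 (v 0) (v 1)) \<le> (K * norm p + K * norm p + K * norm w) * (norm (v 0) * norm (v 1))"
      by (simp add: algebra_simps)
    have b3: "norm (T (fst (v 0)) (snd (v 1)) (snd (v 2))) \<le> K * norm (v 0) * norm (v 1) * norm (v 2)"
      by (intro order_trans[OF bound] mult_mono) (auto simp: K norm_fst_snd_le)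
    show "norm (?a n v) \<le> ?M n * (\<Prod>i<n. norm (v i))"
    proof -
      consider "n = 0" | "n = 1" | "n = 2" | "n = 3" | "n \<ge> 4" by linarith
      then show ?thesis
      proof cases
        case 3
        have "(\<Prod>i<2::nat. norm (v i)) = norm (v 0) * norm (v 1)" by (simp add: numeral_2_eq_2)
        with 3 2 show ?thesis by simp
      next
        case 4
        have "(\<Prod>i<3::nat. norm (v i)) = norm (v 0) * norm (v 1) * norm (v 2)"
          by (simp add: numeral_3_eq_3 numeral_2_eq_2)
        with 4 b3 show ?thesis by (simp add: mult.assoc)
      qed (use 1 in auto)
    qed
  qed
  show "T (fst (z + h)) (snd (z + h)) (snd (z + h)) = (\<Sum>n<4::nat. ?a n (\<lambda>_. h))" for h
  proof -
    have "(\<Sum>n<4::nat. f n) = f 0 + f 1 + f 2 + f 3" for f :: "nat \<Rightarrow> complex"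
      by (simp add: eval_nat_numeral)
    then show ?thesis by (simp add: add1 add2 add3 w_def p_def)
  qed
qed simp

text \<open>Leaving one slot of \<open>T\<close> open gives bounded bilinear maps \<open>L\<close>
  and \<open>R\<close> into spaces of bounded linear maps. The derivative is built from them by
  composition, hence continuous in operator norm.\<close>

lemma complex_C1_trilinear: "complex_C1 (\<lambda>z. T (fst z) (snd z) (snd z))"
proof -
  define L where "L w p = Blinfun (T w p)" for w p
  define R where "R p q = Blinfun (\<lambda>w. T w p q)" for p q
  have "bounded_linear (T w p)" for w p
    by (rule bounded_linear_intro[of _ "K * norm w * norm p"])
       (use bound[of w p] in \<open>auto simp: add3 scaleR mult_ac\<close>)
  then have L: "blinfun_apply (L w p) = T w p" for w p
    by (simp add: L_def bounded_linear_Blinfun_apply)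
  have "bounded_linear (\<lambda>w. T w p q)" for p q
    by (rule bounded_linear_intro[of _ "K * norm p * norm q"])
       (use bound[of _ p q] in \<open>auto simp: add1 scaleR mult_ac\<close>)
  then have R: "blinfun_apply (R p q) = (\<lambda>w. T w p q)" for p q
    by (simp add: R_def bounded_linear_Blinfun_apply)
  interpret L: bounded_bilinear L
  proof
    show "\<exists>K. \<forall>a b. norm (L a b) \<le> norm a * norm b * K"
    proof (intro exI[of _ K] allI norm_blinfun_bound)
      show "norm (L a b x) \<le> norm a * norm b * K * norm x" for a b x
        unfolding L using bound[of a b x] by (simp add: mult_ac)
    qed (simp add: K)
  qed (auto intro!: blinfun_eqI simp: L blinfun.bilinear_simps add1 add2 scaleR)
  interpret R: bounded_bilinear R
  proof
    show "\<exists>K. \<forall>a b. norm (R a b) \<le> norm a * norm b * K"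
    proof (intro exI[of _ K] allI norm_blinfun_bound)
      show "norm (R a b x) \<le> norm a * norm b * K * norm x" for a b x
        unfolding R using bound[of x a b] by (simp add: mult_ac)
    qed (simp add: K)
  qed (auto intro!: blinfun_eqI simp: R blinfun.bilinear_simps add2 add3 scaleR)
  show ?thesis unfolding complex_C1_def
  proof (intro exI conjI allI)
    let ?F = "\<lambda>z. (R (snd z) (snd z) o\<^sub>L fst_blinfun) + 2 *\<^sub>R (L (fst z) (snd z) o\<^sub>L snd_blinfun)"
    show "continuous_on UNIV ?F"
      by (intro continuous_intros bounded_bilinear.continuous_on[OF bounded_bilinear_blinfun_compose]
            L.continuous_on R.continuous_on)
    have eq: "blinfun_apply (?F z) = (\<lambda>h. T (fst h) (snd z) (snd z) + 2 * T (fst z) (snd z) (snd h))" for z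
      by (auto simp: blinfun.bilinear_simps L R scaleR_conv_of_real)
    show "((\<lambda>z. T (fst z) (snd z) (snd z)) has_derivative ?F z) (at z)" for z
    proof -
      have "((\<lambda>z. blinfun_apply (R (snd z) (snd z)) (fst z)) has_derivative
          (\<lambda>h. R (snd z) (snd z) (fst h) + (R (snd z) (snd h) + R (snd h) (snd z)) (fst z))) (at z)"
        by (intro blinfun.FDERIV R.FDERIV derivative_intros has_derivative_ident)
      then have "((\<lambda>z. T (fst z) (snd z) (snd z)) has_derivative
          (\<lambda>h. R (snd z) (snd z) (fst h) + (R (snd z) (snd h) + R (snd h) (snd z)) (fst z))) (at z)"
        by (simp only: R)
      then show ?thesis
        unfolding eq by (rule has_derivative_eq_rhs) (auto simp: fun_eq_iff R blinfun.bilinear_simps intro: sym)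
    qed
    show "?F z (c *\<^sub>C v) = c * ?F z v" for z c v
      unfolding eq by (simp add: scaleC_prod_def scale1 scale3 algebra_simps)
  qed
qed

end

section \<open>Algebra of complex \<open>C1\<close> functions\<close>

lemma complex_C1_add:
  assumes "complex_C1 f" "complex_C1 g"
  shows "complex_C1 (\<lambda>x. f x + g x)"
proof -
  obtain F G where F: "continuous_on UNIV F" "\<And>x. (f has_derivative blinfun_apply (F x)) (at x)"
      "\<And>x c v. blinfun_apply (F x) (c *\<^sub>C v) = c * blinfun_apply (F x) v"
    and G: "continuous_on UNIV G" "\<And>x. (g has_derivative blinfun_apply (G x)) (at x)"
      "\<And>x c v. blinfun_apply (G x) (c *\<^sub>C v) = c * blinfun_apply (G x) v"
    using assms unfolding complex_C1_def by metis
  show ?thesis unfolding complex_C1_def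
  proof (intro exI conjI allI)
    let ?H = "\<lambda>x. F x + G x"
    show "continuous_on UNIV ?H" by (intro continuous_intros F G)
    show "((\<lambda>x. f x + g x) has_derivative ?H x) (at x)" for x
      using has_derivative_add[OF F(2)[of x] G(2)[of x]] by (simp add: blinfun.bilinear_simps[abs_def] plus_blinfun.rep_eq)
    show "?H x (c *\<^sub>C v) = c * ?H x v" for x c v
      by (simp add: blinfun.bilinear_simps F G algebra_simps)
  qed
qed

lemma complex_C1_mult:
  assumes "complex_C1 f" "complex_C1 g"
  shows "complex_C1 (\<lambda>x. f x * g x)"
proof -
  obtain F G where F: "continuous_on UNIV F" "\<And>x. (f has_derivative blinfun_apply (F x)) (at x)"
      "\<And>x c v. blinfun_apply (F x) (c *\<^sub>C v) = c * blinfun_apply (F x) v"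
    and G: "continuous_on UNIV G" "\<And>x. (g has_derivative blinfun_apply (G x)) (at x)"
      "\<And>x c v. blinfun_apply (G x) (c *\<^sub>C v) = c * blinfun_apply (G x) v"
    using assms unfolding complex_C1_def by metis
  have cont: "continuous_on UNIV f" "continuous_on UNIV g"
    using F(2) G(2) by (auto intro!: continuous_at_imp_continuous_on has_derivative_continuous)
  show ?thesis unfolding complex_C1_def
  proof (intro exI conjI allI)
    let ?H = "\<lambda>x. (blinfun_mult_right (f x) o\<^sub>L G x) + (blinfun_mult_right (g x) o\<^sub>L F x)"
    show "continuous_on UNIV ?H"
      by (intro continuous_on_add bounded_bilinear.continuous_on[OF bounded_bilinear_blinfun_compose]
            bounded_linear.continuous_on[OF bounded_linear_blinfun_mult_right] cont F G)
    have eq: "blinfun_apply (?H x) = (\<lambda>h. f x * G x h + F x h * g x)" for x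
      by (auto simp: blinfun.bilinear_simps blinfun_mult_right.rep_eq)
    show "((\<lambda>x. f x * g x) has_derivative ?H x) (at x)" for x
      unfolding eq by (rule has_derivative_mult[OF F(2) G(2)])
    show "?H x (c *\<^sub>C v) = c * ?H x v" for x c v
      unfolding eq by (simp add: F G algebra_simps)
  qed
qed

lemma complex_C1_linear:
  fixes L :: "'a::complex_normed_vector \<Rightarrow> complex"
  assumes "bounded_linear L" "\<And>c x. L (c *\<^sub>C x) = c * L x"
  shows "complex_C1 L"
  unfolding complex_C1_def
  by (intro exI[of _ "\<lambda>_. Blinfun L"])
     (auto simp: bounded_linear_Blinfun_apply assms bounded_linear_imp_has_derivative)

lemma complex_C1_const: "complex_C1 (\<lambda>_. c)"
  unfolding complex_C1_def by (intro exI[of _ "\<lambda>_. 0"]) (auto simp: zero_blinfun.rep_eq[abs_def])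


section \<open>Gradients and brackets of the moments\<close>

lemma is_distribution_summable:
  assumes "g summable_on UNIV"
  shows "is_distribution g"
  unfolding is_distribution_def
  by (intro exI[of _ "\<Sum>\<^sub>\<infinity>k. norm (g k)"] exI[of _ 0]) (simp add: norm_le_infsum_norm assms)

text \<open>Both sequences represent the same derivative. Evaluating it at the vectors of
  \<open>exists_fc_delta\<close> compares the positive entries; the others vanish by
  definition.\<close>

lemma has_gradient_w_unique:
  assumes "has_gradient_w F z g" "has_gradient_w F z g'"
  shows "g = g'"
proof
  fix k
  obtain D where D: "((\<lambda>w. F (w, snd z)) has_derivative D) (at (fst z))"
    "\<And>v. ((\<lambda>k. g k * fc v k) has_sum D v) UNIV"
    using assms(1) unfolding has_gradient_w_def fc_def by blast
  obtain D' where D': "((\<lambda>w. F (w, snd z)) has_derivative D') (at (fst z))"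
    "\<And>v. ((\<lambda>k. g' k * fc v k) has_sum D' v) UNIV"
    using assms(2) unfolding has_gradient_w_def fc_def by blast
  have DD: "D = D'" using D(1) D'(1) by (rule has_derivative_unique)
  show "g k = g' k"
  proof (cases "k \<ge> 1")
    case True
    then obtain v where v: "fc v = (\<lambda>j. if j = k then 1 else 0)" using exists_fc_delta by blast
    have "((\<lambda>j. a j * fc v j) has_sum a k) UNIV" for a
      by (rule has_sum_finite_neutralI[of "{k}"]) (auto simp: v)
    then show ?thesis using D(2)[of v] D'(2)[of v] unfolding DD by (metis has_sum_unique)
  qed (use assms in \<open>auto simp: has_gradient_w_def\<close>)
qed

text \<open>Exchanging the two variables transfers every fact about \<open>w\<close>-gradients to
  \<open>p\<close>-gradients.\<close>

lemma has_gradient_p_swap: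
  "has_gradient_p F z g \<longleftrightarrow> has_gradient_w (\<lambda>(w, p). F (p, w)) (snd z, fst z) g"
  by (simp add: has_gradient_p_def has_gradient_w_def)

lemma has_gradient_p_unique: "has_gradient_p F z g \<Longrightarrow> has_gradient_p F z g' \<Longrightarrow> g = g'"
  unfolding has_gradient_p_swap by (rule has_gradient_w_unique)

text \<open>Summability is stronger than being a distribution, is preserved by sums and by the
  Leibniz rule, and makes the pairing of any two such gradients converge.\<close>

definition l1_gradients :: "(phase_space \<Rightarrow> complex) \<Rightarrow> phase_space \<Rightarrow> (int \<Rightarrow> complex) \<Rightarrow> (int \<Rightarrow> complex) \<Rightarrow> bool"
  where "l1_gradients F z g h \<longleftrightarrow> has_gradient_w F z g \<and> has_gradient_p F z h \<and>
    g summable_on UNIV \<and> h summable_on UNIV"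

lemma has_gradient_w_add:
  assumes "has_gradient_w F z g" "has_gradient_w G z h" "g summable_on UNIV" "h summable_on UNIV"
  shows "has_gradient_w (\<lambda>z. F z + G z) z (\<lambda>k. g k + h k)"
proof -
  obtain D where D: "((\<lambda>w. F (w, snd z)) has_derivative D) (at (fst z))"
    "\<And>v. ((\<lambda>k. g k * fcoeff (fn v) k) has_sum D v) UNIV"
    using assms(1) unfolding has_gradient_w_def by blast
  obtain D' where D': "((\<lambda>w. G (w, snd z)) has_derivative D') (at (fst z))"
    "\<And>v. ((\<lambda>k. h k * fcoeff (fn v) k) has_sum D' v) UNIV"
    using assms(2) unfolding has_gradient_w_def by blast
  have "\<forall>v. ((\<lambda>k. (g k + h k) * fcoeff (fn v) k) has_sum (D v + D' v)) UNIV"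
    unfolding distrib_right by (intro allI has_sum_add D D')
  with has_derivative_add[OF D(1) D'(1)] show ?thesis
    using assms unfolding has_gradient_w_def by (auto intro: is_distribution_summable summable_on_add)
qed

lemma has_gradient_w_mult:
  assumes "has_gradient_w F z g" "has_gradient_w G z h" "g summable_on UNIV" "h summable_on UNIV"
  shows "has_gradient_w (\<lambda>z. F z * G z) z (\<lambda>k. F z * h k + G z * g k)"
proof -
  obtain D where D: "((\<lambda>w. F (w, snd z)) has_derivative D) (at (fst z))"
    "\<And>v. ((\<lambda>k. g k * fcoeff (fn v) k) has_sum D v) UNIV"
    using assms(1) unfolding has_gradient_w_def by blast
  obtain D' where D': "((\<lambda>w. G (w, snd z)) has_derivative D') (at (fst z))"
    "\<And>v. ((\<lambda>k. h k * fcoeff (fn v) k) has_sum D' v) UNIV"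
    using assms(2) unfolding has_gradient_w_def by blast
  have "\<forall>v. ((\<lambda>k. (F z * h k + G z * g k) * fcoeff (fn v) k) has_sum (F z * D' v + G z * D v)) UNIV"
    unfolding distrib_right mult.assoc by (intro allI has_sum_add has_sum_cmult_right D D')
  moreover have "((\<lambda>w. F (w, snd z) * G (w, snd z)) has_derivative (\<lambda>v. F z * D' v + G z * D v)) (at (fst z))"
    using has_derivative_mult[OF D(1) D'(1)] by (simp add: mult.commute)
  ultimately show ?thesis
    using assms unfolding has_gradient_w_def
    by (auto intro!: is_distribution_summable summable_on_add summable_on_cmult_right)
qed

lemma l1_gradients_add:
  assumes "l1_gradients F z g h" "l1_gradients G z g' h'"
  shows "l1_gradients (\<lambda>z. F z + G z) z (\<lambda>k. g k + g' k) (\<lambda>k. h k + h' k)"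
  using assms has_gradient_w_add[of F z g G g'] 
    has_gradient_w_add[of "\<lambda>(w, p). F (p, w)" "(snd z, fst z)" h "\<lambda>(w, p). G (p, w)" h']
  by (auto simp: l1_gradients_def has_gradient_p_swap case_prod_unfold intro: summable_on_add)

lemma l1_gradients_mult:
  assumes "l1_gradients F z g h" "l1_gradients G z g' h'"
  shows "l1_gradients (\<lambda>z. F z * G z) z (\<lambda>k. F z * g' k + G z * g k) (\<lambda>k. F z * h' k + G z * h k)"
  using assms has_gradient_w_mult[of F z g G g'] 
    has_gradient_w_mult[of "\<lambda>(w, p). F (p, w)" "(snd z, fst z)" h "\<lambda>(w, p). G (p, w)" h']
  by (auto simp: l1_gradients_def has_gradient_p_swap case_prod_unfold intro!: summable_on_add summable_on_cmult_right)

lemma l1_gradients_const: "l1_gradients (\<lambda>_. c) z (\<lambda>_. 0) (\<lambda>_. 0)"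
  by (auto simp: l1_gradients_def has_gradient_w_def has_gradient_p_def is_distribution_summable
      intro!: exI[of _ "\<lambda>_. 0"])

lemma l1_gradients_eq:
  assumes "l1_gradients F z g h"
  shows "gradient_w F z = g" "gradient_p F z = h" "\<exists>!g. has_gradient_w F z g" "\<exists>!h. has_gradient_p F z h"
proof -
  have g: "has_gradient_w F z g" and h: "has_gradient_p F z h" using assms by (auto simp: l1_gradients_def)
  show "gradient_w F z = g" unfolding gradient_w_def
    by (rule the_equality) (rule g, rule has_gradient_w_unique[OF _ g])
  show "gradient_p F z = h" unfolding gradient_p_def
    by (rule the_equality) (rule h, rule has_gradient_p_unique[OF _ h])
  show "\<exists>!g. has_gradient_w F z g" using g has_gradient_w_unique by blast
  show "\<exists>!h. has_gradient_p F z h" using h has_gradient_p_unique by blast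
qed

text \<open>Collects what the theorem needs of a function, namely analyticity, the \<open>C1\<close>
  property and gradients with convergent pairings, in a class closed under sums and
  products.\<close>

definition observable :: "(phase_space \<Rightarrow> complex) \<Rightarrow> bool"
  where "observable F \<longleftrightarrow> (\<forall>z. polynomial_at F z) \<and> complex_C1 F \<and> (\<forall>z. \<exists>g h. l1_gradients F z g h)"

lemma observable_gradients:
  assumes "observable F"
  shows "l1_gradients F z (gradient_w F z) (gradient_p F z)"
proof -
  obtain g h where gh: "l1_gradients F z g h" using assms unfolding observable_def by blast
  show ?thesis unfolding l1_gradients_eq(1,2)[OF gh] by (rule gh)
qed

lemma observable_const: "observable (\<lambda>_. c)"
  unfolding observable_def
  by (intro conjI allI exI polynomial_at_const complex_C1_const) (rule l1_gradients_const)

lemma observable_add: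
  assumes "observable F" "observable G"
  shows "observable (\<lambda>z. F z + G z)"
  unfolding observable_def
proof (intro conjI allI)
  show "polynomial_at (\<lambda>z. F z + G z) z" for z
    using assms by (intro polynomial_at_add) (simp_all add: observable_def del: split_paired_All)
  show "complex_C1 (\<lambda>z. F z + G z)"
    using assms by (intro complex_C1_add) (simp_all add: observable_def del: split_paired_All)
  show "\<exists>g h. l1_gradients (\<lambda>z. F z + G z) z g h" for z
    using l1_gradients_add[OF observable_gradients[OF assms(1)] observable_gradients[OF assms(2)]] by blast
qed

lemma observable_mult:
  assumes "observable F" "observable G"
  shows "observable (\<lambda>z. F z * G z)"
  unfolding observable_def
proof (intro conjI allI)
  show "polynomial_at (\<lambda>z. F z * G z) z" for z
    using assms by (intro polynomial_at_mult) (simp_all add: observable_def del: split_paired_All)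
  show "complex_C1 (\<lambda>z. F z * G z)"
    using assms by (intro complex_C1_mult) (simp_all add: observable_def del: split_paired_All)
  show "\<exists>g h. l1_gradients (\<lambda>z. F z * G z) z g h" for z
    using l1_gradients_mult[OF observable_gradients[OF assms(1)] observable_gradients[OF assms(2)]] by blast
qed

lemma observable_diff: "observable F \<Longrightarrow> observable G \<Longrightarrow> observable (\<lambda>z. F z - G z)"
  using observable_add[OF _ observable_mult[OF observable_const[of "-1"]], of F G] by simp

lemma observable_sum: "(\<And>i. i \<in> A \<Longrightarrow> observable (F i)) \<Longrightarrow> observable (\<lambda>z. \<Sum>i\<in>A. F i z)"
  by (induction A rule: infinite_finite_induct) (auto intro: observable_const observable_add)

section \<open>Poisson brackets of observables\<close>

lemma observable_poisson_defined:
  assumes "observable F" "observable G"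
  shows "poisson_defined F G z"
proof -
  note F = observable_gradients[OF assms(1), of z] and G = observable_gradients[OF assms(2), of z]
  show ?thesis
    unfolding poisson_defined_def
    using l1_gradients_eq(3,4)[OF F] l1_gradients_eq(3,4)[OF G] F G assms
    by (auto simp: observable_def l1_gradients_def intro!: summable_on_mult)
qed

text \<open>Merging the two pairings into one series reduces antisymmetry, additivity and the
  Leibniz rule to termwise identities and uniqueness of sums.\<close>

lemma poisson_bracket_has_sum:
  assumes "observable F" "observable G"
  shows "((\<lambda>k. gradient_p F z k * gradient_w G z k - gradient_w F z k * gradient_p G z k)
    has_sum poisson_bracket F G z) UNIV"
  unfolding poisson_bracket_def coeff_pairing_def
  by (intro has_sum_diff has_sum_infsum)
     (use observable_poisson_defined[OF assms] in \<open>auto simp: poisson_defined_def\<close>)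

lemma poisson_bracket_anticommute:
  assumes "observable F" "observable G"
  shows "poisson_bracket F G z = - poisson_bracket G F z"
  using has_sum_unique[OF poisson_bracket_has_sum[OF assms] , OF has_sum_cong[THEN iffD1,
      OF _ has_sum_uminusI[OF poisson_bracket_has_sum[OF assms(2,1)]]]]
  by (simp add: mult.commute)

lemma poisson_bracket_add:
  assumes "observable F" "observable G" "observable K"
  shows "poisson_bracket (\<lambda>z. F z + G z) K z = poisson_bracket F K z + poisson_bracket G K z"
proof -
  note g = l1_gradients_add[OF observable_gradients[OF assms(1)] observable_gradients[OF assms(2)], of z]
  have "((\<lambda>k. (gradient_p F z k + gradient_p G z k) * gradient_w K z k -
      (gradient_w F z k + gradient_w G z k) * gradient_p K z k) has_sum
      (poisson_bracket F K z + poisson_bracket G K z)) UNIV"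
    using has_sum_add[OF poisson_bracket_has_sum[OF assms(1,3), of z] poisson_bracket_has_sum[OF assms(2,3), of z]]
    by (simp add: algebra_simps)
  from has_sum_unique[OF _ this] show ?thesis
    using poisson_bracket_has_sum[OF observable_add[OF assms(1,2)] assms(3), of z]
    unfolding l1_gradients_eq(1,2)[OF g] .
qed

lemma poisson_bracket_mult:
  assumes "observable F" "observable G" "observable K"
  shows "poisson_bracket (\<lambda>z. F z * G z) K z = F z * poisson_bracket G K z + G z * poisson_bracket F K z"
proof -
  note g = l1_gradients_mult[OF observable_gradients[OF assms(1)] observable_gradients[OF assms(2)], of z]
  have "((\<lambda>k. (F z * gradient_p G z k + G z * gradient_p F z k) * gradient_w K z k -
      (F z * gradient_w G z k + G z * gradient_w F z k) * gradient_p K z k) has_sum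
      (F z * poisson_bracket G K z + G z * poisson_bracket F K z)) UNIV"
    using has_sum_add[OF has_sum_cmult_right[OF poisson_bracket_has_sum[OF assms(2,3), of z], of "F z"]
      has_sum_cmult_right[OF poisson_bracket_has_sum[OF assms(1,3), of z], of "G z"]]
    by (simp add: algebra_simps)
  from has_sum_unique[OF _ this] show ?thesis
    using poisson_bracket_has_sum[OF observable_mult[OF assms(1,2)] assms(3), of z]
    unfolding l1_gradients_eq(1,2)[OF g] .
qed

lemma poisson_bracket_const: "poisson_bracket (\<lambda>_. c) K z = 0"
  by (simp add: poisson_bracket_def coeff_pairing_def l1_gradients_eq(1,2)[OF l1_gradients_const])

lemma poisson_bracket_diff:
  assumes "observable F" "observable G" "observable K"
  shows "poisson_bracket (\<lambda>z. F z - G z) K z = poisson_bracket F K z - poisson_bracket G K z"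
  using poisson_bracket_add[OF assms(1) observable_mult[OF observable_const[of "-1"] assms(2)] assms(3)]
    poisson_bracket_mult[OF observable_const[of "-1"] assms(2,3)] poisson_bracket_const
  by simp

lemma poisson_bracket_sum:
  assumes "\<And>i. i \<in> A \<Longrightarrow> observable (F i)" "observable K"
  shows "poisson_bracket (\<lambda>z. \<Sum>i\<in>A. F i z) K z = (\<Sum>i\<in>A. poisson_bracket (F i) K z)"
  using assms(1)
  by (induction A rule: infinite_finite_induct)
     (simp_all add: poisson_bracket_const poisson_bracket_add observable_sum assms(2))

section \<open>The moments as bounded multilinear forms\<close>

lemma l1_const_nonneg: "l1_const \<ge> 0"
  by (auto simp: l1_const_def intro!: infsum_nonneg)

lemma fc_fun_add: "fc (x + y) = (\<lambda>k. fc x k + fc y k)"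
  by (rule ext) (rule fc_add)

lemma fc_fun_scaleC: "fc (c *\<^sub>C x) = (\<lambda>k. c * fc x k)"
  by (rule ext) (rule fc_scaleC)

lemma summable_on_cmult:
  fixes a :: "'i \<Rightarrow> complex"
  shows "a summable_on A \<Longrightarrow> (\<lambda>i. c * a i) summable_on A"
  by (rule summable_on_cmult_right)

interpretation corr: bilinear_form "\<lambda>w p. corr (fc w) (fc p) m" "l1_const * l1_const" for m
proof
  fix w w' p p' :: hplus0 and c
  show "corr (fc (w + c *\<^sub>C w')) (fc p) m = corr (fc w) (fc p) m + c * corr (fc w') (fc p) m"
    by (simp add: fc_fun_add fc_fun_scaleC corr_add_left corr_cmult_left summable_on_cmult)
  show "corr (fc w) (fc (p + c *\<^sub>C p')) m = corr (fc w) (fc p) m + c * corr (fc w) (fc p') m"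
    by (simp add: fc_fun_add fc_fun_scaleC corr_add_right corr_cmult_right summable_on_cmult)
  have "norm (corr (fc w) (fc p) m) \<le> (l1_const * norm w) * (\<Sum>\<^sub>\<infinity>j. norm (fc p j))"
    by (rule norm_corr_le) (simp_all add: norm_fc_le)
  also have "\<dots> \<le> (l1_const * norm w) * (l1_const * norm p)"
    by (intro mult_left_mono infsum_norm_fc_le) (simp add: l1_const_nonneg)
  finally show "norm (corr (fc w) (fc p) m) \<le> l1_const * l1_const * norm w * norm p"
    by (simp add: mult_ac)
qed (simp add: l1_const_nonneg)

interpretation corr2: trilinear_form "\<lambda>w p q. corr (corr (fc w) (fc p)) (fc q) m" "l1_const * l1_const * l1_const" for m
proof
  fix w w' p p' q :: hplus0 and c
  show "corr (corr (fc (w + c *\<^sub>C w')) (fc p)) (fc q) m =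
      corr (corr (fc w) (fc p)) (fc q) m + c * corr (corr (fc w') (fc p)) (fc q) m"
    unfolding corr.lin1 by (simp add: corr_add_left corr_cmult_left summable_on_cmult corr_summable)
  show "corr (corr (fc w) (fc (p + c *\<^sub>C p'))) (fc q) m =
      corr (corr (fc w) (fc p)) (fc q) m + c * corr (corr (fc w) (fc p')) (fc q) m"
    unfolding corr.lin2 by (simp add: corr_add_left corr_cmult_left summable_on_cmult corr_summable)
  show "corr (corr (fc w) (fc p)) (fc q) m = corr (corr (fc w) (fc q)) (fc p) m"
    by (rule corr_corr_commute) simp_all
  have "norm (corr (corr (fc w) (fc p)) (fc q) m) \<le> (l1_const * l1_const * norm w * norm p) * (\<Sum>\<^sub>\<infinity>j. norm (fc q j))"
    by (rule norm_corr_le) (simp_all add: corr.bound)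
  also have "\<dots> \<le> (l1_const * l1_const * norm w * norm p) * (l1_const * norm q)"
    by (intro mult_left_mono infsum_norm_fc_le) (simp add: l1_const_nonneg)
  finally show "norm (corr (corr (fc w) (fc p)) (fc q) m) \<le> l1_const * l1_const * l1_const * norm w * norm p * norm q"
    by (simp add: mult_ac)
qed (simp add: l1_const_nonneg)

section \<open>Gradients of the moments\<close>

lemma l1_gradients_momw:
  assumes "m \<ge> 1"
  shows "l1_gradients (momw m) z (\<lambda>k. if k = m then 1 else 0) (\<lambda>_. 0)"
proof -
  have s: "(\<lambda>k. if k = m then 1 else 0 :: complex) summable_on UNIV"
    by (rule finite_nonzero_values_imp_summable_on) (auto intro: finite_subset[of _ "{m}"])
  have bl: "bounded_linear (\<lambda>w. fc w m)"
    by (rule bounded_linear_intro[of _ l1_const]) (auto simp: fc_add fc_scaleR norm_fc_le mult.commute)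
  have "((\<lambda>k. (if k = m then 1 else 0) * fc v k) has_sum fc v m) UNIV" for v
    by (rule has_sum_finite_neutralI[of "{m}"]) auto
  with bl have "has_gradient_w (momw m) z (\<lambda>k. if k = m then 1 else 0)"
    unfolding has_gradient_w_def momw_def fc_def[symmetric] fst_conv
    using s assms by (auto intro!: is_distribution_summable exI[of _ "\<lambda>v. fc v m"] bounded_linear_imp_has_derivative)
  moreover have "has_gradient_p (momw m) z (\<lambda>_. 0)"
    unfolding has_gradient_p_def momw_def by (auto intro!: is_distribution_summable exI[of _ "\<lambda>_. 0"])
  ultimately show ?thesis using s by (simp add: l1_gradients_def)
qed

text \<open>Bilinearity makes each partial derivative the form itself with one slot free. The
  shifted \<open>p\<close> is supported on positive indices because \<open>m \<ge> 0\<close>; the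
  shifted \<open>w\<close> has to be cut off at \<open>k \<ge> 1\<close>, as a gradient must vanish
  at nonpositive frequencies.\<close>

lemma l1_gradients_momu:
  assumes "m \<ge> 0"
  shows "l1_gradients (momu m) z (\<lambda>k. fc (snd z) (k - m)) (\<lambda>k. if k \<ge> 1 then fc (fst z) (m + k) else 0)"
proof -
  have s: "(\<lambda>k. if k \<ge> 1 then fc (fst z) (m + k) else 0) summable_on UNIV"
    by (rule summable_on_restrict) simp
  have "((\<lambda>k. fc (snd z) (k - m) * fc v k) has_sum corr (fc v) (fc (snd z)) m) UNIV" for v
  proof -
    have "((\<lambda>j. fc v (m + j) * fc (snd z) j) has_sum corr (fc v) (fc (snd z)) m) UNIV"
      by (rule corr_has_sum) simp_all
    also have "?this \<longleftrightarrow> ?thesis"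
      by (rule has_sum_reindex_bij_witness[of _ "\<lambda>k. k - m" "\<lambda>j. m + j"]) auto
    finally show ?thesis .
  qed
  then have "has_gradient_w (momu m) z (\<lambda>k. fc (snd z) (k - m))"
    unfolding has_gradient_w_def momu_def fc_def[symmetric] fst_conv snd_conv
    using assms by (auto intro!: is_distribution_summable exI[of _ "\<lambda>v. corr (fc v) (fc (snd z)) m"]
        bounded_linear_imp_has_derivative corr.bounded_linear_left)
  moreover
  have "((\<lambda>k. (if k \<ge> 1 then fc (fst z) (m + k) else 0) * fc v k) has_sum corr (fc (fst z)) (fc v) m) UNIV" for v
    using corr_has_sum[of "fc (fst z)" "fc v" m]
    by (rule has_sum_cong[THEN iffD1, rotated]) auto
  then have "has_gradient_p (momu m) z (\<lambda>k. if k \<ge> 1 then fc (fst z) (m + k) else 0)"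
    unfolding has_gradient_p_def momu_def fc_def[symmetric] fst_conv snd_conv
    using s by (auto intro!: is_distribution_summable exI[of _ "\<lambda>v. corr (fc (fst z)) (fc v) m"]
        bounded_linear_imp_has_derivative corr.bounded_linear_right)
  ultimately show ?thesis using s by (simp add: l1_gradients_def)
qed

lemma conv_nonpos:
  assumes "n \<le> 0"
  shows "conv (fc p) (fc q) n = 0"
proof -
  have "fc p (n - j) * fc q j = 0" for j using assms by (cases "j \<le> 0") auto
  then show ?thesis unfolding conv_def by (rule infsum_0)
qed

text \<open>The \<open>w\<close>-gradient is the coefficient sequence found in
  \<open>corr_corr_has_sum\<close>. In \<open>p\<close> the function is the quadratic form of a
  symmetric bilinear form, whence the factor 2.\<close>

lemma l1_gradients_momv:
  assumes "m \<ge> 0"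
  shows "l1_gradients (momv m) z (\<lambda>k. conv (fc (snd z)) (fc (snd z)) (k - m))
    (\<lambda>k. if k \<ge> 1 then 2 * corr (fc (fst z)) (fc (snd z)) (m + k) else 0)"
proof -
  let ?w = "fst z" and ?p = "snd z"
  have s: "(\<lambda>k. if k \<ge> 1 then 2 * corr (fc ?w) (fc ?p) (m + k) else 0) summable_on UNIV"
    by (rule summable_on_restrict) (simp add: summable_on_cmult corr_summable)
  have s': "(\<lambda>k. conv (fc ?p) (fc ?p) (k - m)) summable_on UNIV"
    by (simp add: conv_summable)
  have "((\<lambda>k. conv (fc ?p) (fc ?p) (k - m) * fc v k) has_sum corr (corr (fc v) (fc ?p)) (fc ?p) m) UNIV" for v
    by (rule corr_corr_has_sum) simp_all
  moreover have "bounded_linear (\<lambda>w. corr (corr (fc w) (fc ?p)) (fc ?p) m)"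
    by (rule bounded_linear_intro[of _ "l1_const * l1_const * l1_const * norm ?p * norm ?p"])
       (use corr2.bound[of _ ?p ?p m] in \<open>auto simp: corr2.add1 corr2.scaleR mult_ac\<close>)
  ultimately have grad_w: "has_gradient_w (momv m) z (\<lambda>k. conv (fc ?p) (fc ?p) (k - m))"
    unfolding has_gradient_w_def momv_def fc_def[symmetric] fst_conv snd_conv
    using assms s' by (auto intro!: is_distribution_summable exI[of _ "\<lambda>v. corr (corr (fc v) (fc ?p)) (fc ?p) m"]
        bounded_linear_imp_has_derivative conv_nonpos)
  have "((\<lambda>k. (if k \<ge> 1 then 2 * corr (fc ?w) (fc ?p) (m + k) else 0) * fc v k) has_sum
      2 * corr (corr (fc ?w) (fc ?p)) (fc v) m) UNIV" for v
    using has_sum_cmult_right[OF corr_has_sum[of "corr (fc ?w) (fc ?p)" "fc v" m], of 2]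
    by (rule has_sum_cong[THEN iffD1, rotated]) (auto simp: corr_summable)
  moreover have "((\<lambda>p. corr (corr (fc ?w) (fc p)) (fc p) m) has_derivative
      (\<lambda>v. 2 * corr (corr (fc ?w) (fc ?p)) (fc v) m)) (at ?p)"
  proof -
    have "bounded_bilinear (\<lambda>p q. corr (corr (fc ?w) (fc p)) (fc q) m)"
    proof
      show "\<exists>K. \<forall>p q. norm (corr (corr (fc ?w) (fc p)) (fc q) m) \<le> norm p * norm q * K"
        by (intro exI[of _ "l1_const * l1_const * l1_const * norm ?w"] allI)
           (use corr2.bound[of ?w _ _ m] in \<open>simp add: mult_ac\<close>)
    qed (auto simp: corr2.add2 corr2.add3 corr2.scaleR)
    from bounded_bilinear.FDERIV[OF this has_derivative_ident has_derivative_ident]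
    show ?thesis
      by (rule has_derivative_eq_rhs) (auto simp: fun_eq_iff intro: corr2.sym)
  qed
  ultimately have "has_gradient_p (momv m) z (\<lambda>k. if k \<ge> 1 then 2 * corr (fc ?w) (fc ?p) (m + k) else 0)"
    unfolding has_gradient_p_def momv_def fc_def[symmetric] fst_conv snd_conv
    using s by (auto intro!: is_distribution_summable exI[of _ "\<lambda>v. 2 * corr (corr (fc ?w) (fc ?p)) (fc v) m"])
  then show ?thesis using grad_w s s' by (simp add: l1_gradients_def)
qed

lemma observable_momw:
  assumes "m \<ge> 1"
  shows "observable (momw m)"
  unfolding observable_def
proof (intro conjI allI)
  show "polynomial_at (momw m) z" for z
    by (rule polynomial_at_linear[where K = l1_const])
       (auto simp: momw_def fc_add fc_scaleC scaleC_prod_def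
         intro!: order_trans[OF norm_fc_le] mult_left_mono norm_fst_snd_le l1_const_nonneg)
  show "complex_C1 (momw m)"
  proof (rule complex_C1_linear)
    show "bounded_linear (momw m)"
      by (rule bounded_linear_intro[of _ l1_const])
         (auto simp: momw_def fc_add fc_scaleR mult.commute[of _ l1_const]
           intro!: order_trans[OF norm_fc_le] mult_left_mono norm_fst_snd_le l1_const_nonneg)
  qed (simp add: momw_def fc_scaleC scaleC_prod_def)
qed (use l1_gradients_momw[OF assms] in blast)

lemma observable_momu:
  assumes "m \<ge> 0"
  shows "observable (momu m)"
  unfolding observable_def
  using l1_gradients_momu[OF assms] corr.polynomial_at_bilinear[of m] corr.complex_C1_bilinear[of m]
  by (auto simp: momu_def[abs_def])

lemma observable_momv:
  assumes "m \<ge> 0"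
  shows "observable (momv m)"
  unfolding observable_def
  using l1_gradients_momv[OF assms] corr2.polynomial_at_trilinear[of m] corr2.complex_C1_trilinear[of m]
  by (auto simp: momv_def[abs_def])

section \<open>Brackets of the moments\<close>

lemma pairing_shifted_p:
  assumes "n \<ge> 0"
  shows "(\<Sum>\<^sub>\<infinity>k. (if k \<ge> 1 then f (m + k) else 0) * fc p (k - n)) = corr f (fc p) (m + n)"
proof -
  have "(\<Sum>\<^sub>\<infinity>k. (if k \<ge> 1 then f (m + k) else 0) * fc p (k - n)) = (\<Sum>\<^sub>\<infinity>k. f (m + k) * fc p (k - n))"
    \<comment> \<open>The cutoff is invisible: for \<open>k \<le> 0\<close> also
      \<open>k - n \<le> 0\<close>, so the coefficient of \<open>p\<close> vanishes.\<close>
    using assms by (intro infsum_cong) auto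
  also have "\<dots> = corr f (fc p) (m + n)" unfolding corr_def
    by (rule infsum_reindex_bij_witness[of _ "\<lambda>j. n + j" "\<lambda>k. k - n"]) (auto simp: algebra_simps)
  finally show ?thesis .
qed

lemma pairing_shifted_conv:
  assumes "n \<ge> 0" "f summable_on UNIV"
  shows "(\<Sum>\<^sub>\<infinity>k. (if k \<ge> 1 then f (m + k) else 0) * conv (fc p) (fc q) (k - n)) = corr (corr f (fc p)) (fc q) (m + n)"
proof -
  have "(\<Sum>\<^sub>\<infinity>k. (if k \<ge> 1 then f (m + k) else 0) * conv (fc p) (fc q) (k - n)) =
      (\<Sum>\<^sub>\<infinity>k. conv (fc p) (fc q) (k - n) * f (m + k))"
    using assms by (intro infsum_cong) (auto simp: conv_nonpos)
  also have "\<dots> = corr (corr (\<lambda>k. f (m + k)) (fc p)) (fc q) n"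
    using assms by (intro infsumI corr_corr_has_sum) simp_all
  also have "\<dots> = corr (corr f (fc p)) (fc q) (m + n)"
    by (simp add: corr_def add.assoc)
  finally show ?thesis .
qed

lemma pairing_delta: "(\<Sum>\<^sub>\<infinity>k. f k * (if k = n then 1 else 0)) = (f n :: complex)"
  by (rule infsumI, rule has_sum_finite_neutralI[of "{n}"]) auto

lemma bracket_w_w: "m \<ge> 1 \<Longrightarrow> n \<ge> 1 \<Longrightarrow> poisson_bracket (momw m) (momw n) z = 0"
  by (simp add: poisson_bracket_def coeff_pairing_def l1_gradients_eq(1,2)[OF l1_gradients_momw])

lemma bracket_u_w: "m \<ge> 0 \<Longrightarrow> n \<ge> 1 \<Longrightarrow> poisson_bracket (momu m) (momw n) z = momw (m + n) z"
  by (simp add: poisson_bracket_def coeff_pairing_def l1_gradients_eq(1,2)[OF l1_gradients_momw]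
      l1_gradients_eq(1,2)[OF l1_gradients_momu] pairing_delta momw_def)

lemma bracket_v_w: "m \<ge> 0 \<Longrightarrow> n \<ge> 1 \<Longrightarrow> poisson_bracket (momv m) (momw n) z = 2 * momu (m + n) z"
  by (simp add: poisson_bracket_def coeff_pairing_def l1_gradients_eq(1,2)[OF l1_gradients_momw]
      l1_gradients_eq(1,2)[OF l1_gradients_momv] pairing_delta momu_def)

text \<open>Both pairings equal \<open>momu (m + n) z\<close>.\<close>

lemma bracket_u_u: "m \<ge> 0 \<Longrightarrow> n \<ge> 0 \<Longrightarrow> poisson_bracket (momu m) (momu n) z = 0"
  by (simp add: poisson_bracket_def coeff_pairing_def l1_gradients_eq(1,2)[OF l1_gradients_momu]
      pairing_shifted_p mult.commute[of "fc _ _"] add.commute)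

text \<open>The two pairings are \<open>2 * momv (m + n) z\<close> and
  \<open>momv (m + n) z\<close>; the factor 2 comes from differentiating \<open>momv m\<close> in
  \<open>p\<close>.\<close>

lemma bracket_v_u:
  assumes "m \<ge> 0" "n \<ge> 0"
  shows "poisson_bracket (momv m) (momu n) z = momv (m + n) z"
proof -
  let ?w = "fst z" and ?p = "snd z"
  have 1: "(\<Sum>\<^sub>\<infinity>k. (if k \<ge> 1 then 2 * corr (fc ?w) (fc ?p) (m + k) else 0) * fc ?p (k - n)) = 2 * momv (m + n) z"
    unfolding pairing_shifted_p[OF assms(2), of "\<lambda>k. 2 * corr (fc ?w) (fc ?p) k"] corr_cmult_left momv_def ..
  have 2: "(\<Sum>\<^sub>\<infinity>k. conv (fc ?p) (fc ?p) (k - m) * (if k \<ge> 1 then fc ?w (n + k) else 0)) = momv (m + n) z"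
    unfolding mult.commute[of "conv _ _ _"] pairing_shifted_conv[OF assms(1) fc_summable] momv_def add.commute[of n m] ..
  show ?thesis
    unfolding poisson_bracket_def coeff_pairing_def l1_gradients_eq(1,2)[OF l1_gradients_momu[OF assms(2)]]
      l1_gradients_eq(1,2)[OF l1_gradients_momv[OF assms(1)]] 1 2 by simp
qed

text \<open>Both pairings equal the same triple contraction, which depends only on
  \<open>m + n\<close>.\<close>

lemma bracket_v_v:
  assumes "m \<ge> 0" "n \<ge> 0"
  shows "poisson_bracket (momv m) (momv n) z = 0"
proof -
  let ?w = "fst z" and ?p = "snd z"
  let ?f = "\<lambda>k. 2 * corr (fc ?w) (fc ?p) k"
  have f: "?f summable_on UNIV" by (simp add: summable_on_cmult corr_summable)
  have "(\<Sum>\<^sub>\<infinity>k. conv (fc ?p) (fc ?p) (k - m) * (if k \<ge> 1 then ?f (n + k) else 0)) =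
      corr (corr ?f (fc ?p)) (fc ?p) (m + n)"
    unfolding mult.commute[of "conv _ _ _"] pairing_shifted_conv[OF assms(1) f] add.commute[of n m] ..
  then show ?thesis
    unfolding poisson_bracket_def coeff_pairing_def l1_gradients_eq(1,2)[OF l1_gradients_momv[OF assms(2)]]
      l1_gradients_eq(1,2)[OF l1_gradients_momv[OF assms(1)]] pairing_shifted_conv[OF assms(2) f] by simp
qed


section \<open>The brackets of the integrals\<close>

text \<open>If the series \<open>f\<close> and \<open>g\<close> have no constant term, this is the
  coefficient of \<open>x^(k+1) y^(l+1)\<close> in \<open>f(x) g(y)\<close> times the sum of
  \<open>h (m + n) x^m y^n\<close> over \<open>m, n \<ge> 1\<close>.\<close>

definition hankel_sum :: "nat \<Rightarrow> nat \<Rightarrow> (nat \<Rightarrow> 'a) \<Rightarrow> (nat \<Rightarrow> 'a) \<Rightarrow> (nat \<Rightarrow> 'a) \<Rightarrow> 'a::comm_ring_1"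
  where "hankel_sum k l f g h = (\<Sum>i=1..k. \<Sum>j=1..l. f i * g j * h ((k + 1 - i) + (l + 1 - j)))"

lemma sum_interior:
  fixes f :: "nat \<Rightarrow> 'a::comm_monoid_add"
  assumes "f 0 = 0" "f (k + 1) = 0"
  shows "(\<Sum>i=0..k + 1. f i) = (\<Sum>i=1..k. f i)"
  using assms by (intro sum.mono_neutral_right) (auto simp: not_le, metis Suc_leI le_SucE le_antisym)

lemma hankel_sum_antisym:
  fixes u v w :: "nat \<Rightarrow> 'a::idom"
  assumes 0: "u 0 = 0" "v 0 = 0" "w 0 = 0"
  shows "hankel_sum k l u w v - hankel_sum k l u v w - hankel_sum k l w u v
    + hankel_sum k l w v u + hankel_sum k l v u w - hankel_sum k l v w u = 0"
proof -
  \<comment> \<open>Series in \<open>y\<close> whose coefficients are series in \<open>x\<close>: \<open>A f = f(x)\<close>, \<open>B f = f(y)\<close>.\<close>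
  define A where "A f = fps_const (Abs_fps f)" for f :: "nat \<Rightarrow> 'a"
  define B where "B f = Abs_fps (\<lambda>n. fps_const (f n))" for f :: "nat \<Rightarrow> 'a"
  define M where "M h = Abs_fps (\<lambda>n. Abs_fps (\<lambda>m. if m \<ge> 1 \<and> n \<ge> 1 then h (m + n) else 0))" for h :: "nat \<Rightarrow> 'a"
  define X where "X = fps_const (fps_X :: 'a fps)"
  define Y where "Y = (fps_X :: 'a fps fps)"
  \<comment> \<open>The constant terms in \<open>y\<close> differ, so \<open>X - Y\<close> is
    nonzero and can be cancelled in the domain of iterated power series.\<close>
  have "fps_nth X 0 \<noteq> fps_nth Y 0" by (simp add: X_def Y_def)
  then have XY: "X - Y \<noteq> 0" by auto
  \<comment> \<open>The coefficient at \<open>x^m y^n\<close> is a difference of two entries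
    depending only on \<open>m + n - 1\<close>; it cancels except along \<open>n = 1\<close> and
    \<open>m = 1\<close>, where \<open>y h(x)\<close> and \<open>- x h(y)\<close> remain. The corner
    terms are covered by \<open>h 0 = 0\<close>.\<close>
  have M: "(X - Y) * M h = Y * A h - X * B h" if "h 0 = 0" for h
  proof (intro fps_ext)
    fix n m
    show "fps_nth (fps_nth ((X - Y) * M h) n) m = fps_nth (fps_nth (Y * A h - X * B h) n) m"
      using that by (cases n; cases m)
        (auto simp: X_def Y_def A_def B_def M_def left_diff_distrib fps_X_mult_nth not_less_eq_eq)
  qed
  have coeff: "fps_nth (fps_nth (A f * B g * M h) (l + 1)) (k + 1) = hankel_sum k l f g h" if "f 0 = 0" "g 0 = 0" for f g h
  proof -
    have "fps_nth (fps_nth (A f * B g * M h) (l + 1)) (k + 1) =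
        fps_nth (Abs_fps f * (\<Sum>j=0..l + 1. fps_const (g j) * fps_nth (M h) (l + 1 - j))) (k + 1)"
      unfolding A_def mult.assoc fps_mult_left_const_nth fps_mult_nth[of "B g"] by (simp add: B_def)
    also have "\<dots> = (\<Sum>i=0..k + 1. f i * (\<Sum>j=0..l + 1. g j * fps_nth (fps_nth (M h) (l + 1 - j)) (k + 1 - i)))"
      by (simp add: fps_mult_nth[of "Abs_fps f"] fps_sum_nth del: sum.cl_ivl_Suc)
    also have "\<dots> = (\<Sum>i=1..k. f i * (\<Sum>j=1..l. g j * fps_nth (fps_nth (M h) (l + 1 - j)) (k + 1 - i)))"
      \<comment> \<open>The index 0 drops out because \<open>f\<close> and \<open>g\<close> vanish
        there, the last index because \<open>M h\<close> has no term of degree 0 in either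
        variable.\<close>
      by (subst sum_interior, simp add: that, simp add: M_def, rule sum.cong[OF refl], subst sum_interior)
         (simp_all add: that M_def)
    also have "\<dots> = hankel_sum k l f g h"
      unfolding hankel_sum_def sum_distrib_left by (intro sum.cong refl) (auto simp: M_def mult_ac)
    finally show ?thesis .
  qed
  \<comment> \<open>Up to sign the determinant with rows \<open>A\<close>, \<open>B\<close>,
    \<open>M\<close> and columns \<open>u\<close>, \<open>v\<close>, \<open>w\<close>; multiplied by
    \<open>X - Y\<close>, its last row is a combination of the first two.\<close>
  define S where "S = A u * B w * M v - A u * B v * M w - A w * B u * M v
    + A w * B v * M u + A v * B u * M w - A v * B w * M u"
  have "(X - Y) * S = A u * B w * ((X - Y) * M v) - A u * B v * ((X - Y) * M w) - A w * B u * ((X - Y) * M v)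
    + A w * B v * ((X - Y) * M u) + A v * B u * ((X - Y) * M w) - A v * B w * ((X - Y) * M u)"
    unfolding S_def by algebra
  also have "\<dots> = 0" unfolding M[of u, OF 0(1)] M[of v, OF 0(2)] M[of w, OF 0(3)] by algebra
  finally have "S = 0" using XY by simp
  then have "fps_nth (fps_nth S (l + 1)) (k + 1) = 0" by simp
  then show ?thesis by (simp only: S_def fps_add_nth fps_sub_nth coeff 0)
qed

section \<open>Brackets of \<open>I_fun k\<close> with \<open>Ham\<close> and with
  \<open>I_fun l\<close>\<close>

lemma observable_moments:
  "i \<ge> 1 \<Longrightarrow> observable (momw (int i))" "observable (momu (int i))" "observable (momv (int i))"
  by (simp_all add: observable_momw observable_momu observable_momv)

lemma I_fun_eq_sum: "I_fun k = (\<lambda>z. \<Sum>i=1..k. momu (int i) z * momu (int (k + 1 - i)) z -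
    momw (int i) z * momv (int (k + 1 - i)) z)"
  by (rule ext) (rule I_fun_eq)

lemma observable_I_fun: "observable (I_fun k)"
  unfolding I_fun_eq_sum
  by (intro observable_sum observable_diff observable_mult observable_moments) auto

text \<open>The Leibniz rule applied to \<open>I_fun_eq\<close>; it reduces all remaining brackets
  to those of the moments.\<close>

lemma bracket_I_fun:
  assumes "observable F"
  shows "poisson_bracket (I_fun k) F z = (\<Sum>i=1..k.
    momu (int i) z * poisson_bracket (momu (int (k + 1 - i))) F z +
    momu (int (k + 1 - i)) z * poisson_bracket (momu (int i)) F z -
    momw (int i) z * poisson_bracket (momv (int (k + 1 - i))) F z -
    momv (int (k + 1 - i)) z * poisson_bracket (momw (int i)) F z)"
  unfolding I_fun_eq_sum
  by (subst poisson_bracket_sum)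
     (auto intro!: sum.cong observable_diff observable_mult observable_moments
       simp: assms poisson_bracket_diff poisson_bracket_mult observable_mult observable_moments simp del: of_nat_diff)

lemma sum_flip: "(\<Sum>i=1..k. f (k + 1 - i)) = (\<Sum>i=1..k. f i)"
  for f :: "nat \<Rightarrow> 'a::comm_monoid_add"
  by (rule sum.reindex_bij_witness[of _ "\<lambda>i. k + 1 - i" "\<lambda>i. k + 1 - i"]) auto

text \<open>With \<open>Ham = momv 0\<close> the Leibniz rule leaves a sum of
  \<open>u i * v (k + 1 - i) - u (k + 1 - i) * v i\<close>, which changes sign under the reflection
  \<open>i\<close> to \<open>k + 1 - i\<close>.\<close>

lemma bracket_I_fun_Ham: "poisson_bracket (I_fun k) Ham z = 0"
proof -
  define u where "u i = momu (int i) z" for i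
  define v where "v i = momv (int i) z" for i
  have "poisson_bracket (momu (int i)) (momv 0) z = - v i" for i
    using poisson_bracket_anticommute[OF observable_moments(2)[of i] observable_moments(3)[of 0], of z]
    by (simp add: bracket_v_u v_def)
  moreover have "poisson_bracket (momw (int i)) (momv 0) z = - 2 * u i" if "i \<ge> 1" for i
    using poisson_bracket_anticommute[OF observable_moments(1)[OF that] observable_moments(3)[of 0], of z] that
    by (simp add: bracket_v_w u_def)
  moreover have "poisson_bracket (momv (int i)) (momv 0) z = 0" for i
    by (simp add: bracket_v_v)
  ultimately have "poisson_bracket (I_fun k) Ham z = (\<Sum>i=1..k. u i * v (k + 1 - i) - u (k + 1 - i) * v i)"
    unfolding Ham_eq bracket_I_fun[OF observable_momv[OF order_refl]]
    by (intro sum.cong refl) (auto simp: u_def v_def algebra_simps simp del: of_nat_diff)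
  also have "\<dots> = 0"
    using sum_flip[of "\<lambda>i. u i * v (k + 1 - i)" k] by (simp add: sum_subtractf)
  finally show ?thesis .
qed

text \<open>The Leibniz rule in \<open>I_fun l\<close> gives the inner sums \<open>Q\<close>, the
  one in \<open>I_fun k\<close> the outer sums \<open>P\<close>. Together they form twice the
  alternating combination of \<open>hankel_sum_antisym\<close>.\<close>

lemma bracket_I_fun_I_fun: "poisson_bracket (I_fun k) (I_fun l) z = 0"
proof -
  \<comment> \<open>The value 0 at index 0 meets the hypotheses of
    \<open>hankel_sum_antisym\<close>; the brackets below involve only indices at least 1, where
    these are the actual moments.\<close>
  define w where "w i = (if i = 0 then 0 else momw (int i) z)" for i
  define u where "u i = (if i = 0 then 0 else momu (int i) z)" for i
  define v where "v i = (if i = 0 then 0 else momv (int i) z)" for i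
  define Q where "Q f h i = (\<Sum>j=1..l. f j * h (i + (l + 1 - j)))" for f h :: "nat \<Rightarrow> complex" and i
  \<comment> \<open>Reflecting \<open>j\<close> to \<open>l + 1 - j\<close> brings both halves of
    the Leibniz rule to the same form \<open>Q\<close>.\<close>
  have Q_flip: "(\<Sum>j=1..l. f (l + 1 - j) * h (i + j)) = Q f h i" for f h i
    unfolding Q_def by (subst sum_flip[symmetric]) (auto intro!: sum.cong)
  note anti = poisson_bracket_anticommute[OF _ observable_I_fun, of _ l z]
  have W: "poisson_bracket (momw (int i)) (I_fun l) z = 2 * Q w u i - 2 * Q u w i" if i: "i \<ge> 1" for i
  proof -
    have "poisson_bracket (I_fun l) (momw (int i)) z =
        (\<Sum>j=1..l. u j * w (i + (l + 1 - j)) + u (l + 1 - j) * w (i + j) - 2 * (w j * u (i + (l + 1 - j))))"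
      unfolding bracket_I_fun[OF observable_moments(1)[OF i]]
    proof (rule sum.cong[OF refl], goal_cases)
      case (1 j)
      define j' where "j' = l + 1 - j"
      have "j \<ge> 1" "j' \<ge> 1" using 1 by (auto simp: j'_def)
      with i show ?case unfolding j'_def[symmetric]
        using bracket_u_w[of "int j'" "int i" z] bracket_u_w[of "int j" "int i" z]
          bracket_v_w[of "int j'" "int i" z] bracket_w_w[of "int j" "int i" z]
        by (simp add: u_def w_def add.commute flip: of_nat_add)
    qed
    also have "\<dots> = 2 * Q u w i - 2 * Q w u i"
      by (simp only: sum.distrib sum_subtractf sum_distrib_left[symmetric] Q_flip) (simp add: Q_def)
    finally show ?thesis using anti[OF observable_moments(1)[OF i]] by simp
  qed
  have U: "poisson_bracket (momu (int i)) (I_fun l) z = Q w v i - Q v w i" if i: "i \<ge> 1" for i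
  proof -
    have wu: "poisson_bracket (momw (int j)) (momu (int i)) z = - w (i + j)" if "j \<ge> 1" for j
      using poisson_bracket_anticommute[OF observable_moments(1)[OF that] observable_moments(2)[of i], of z]
        bracket_u_w[of "int i" "int j" z] that i
      by (simp add: w_def flip: of_nat_add)
    have "poisson_bracket (I_fun l) (momu (int i)) z =
        (\<Sum>j=1..l. v (l + 1 - j) * w (i + j) - w j * v (i + (l + 1 - j)))"
      unfolding bracket_I_fun[OF observable_moments(2)]
    proof (rule sum.cong[OF refl], goal_cases)
      case (1 j)
      define j' where "j' = l + 1 - j"
      have "j \<ge> 1" "j' \<ge> 1" using 1 by (auto simp: j'_def)
      with i show ?case unfolding j'_def[symmetric]
        using bracket_u_u[of "int j'" "int i" z] bracket_u_u[of "int j" "int i" z]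
          bracket_v_u[of "int j'" "int i" z] wu[of j]
        by (simp add: v_def w_def add.commute flip: of_nat_add)
    qed
    also have "\<dots> = Q v w i - Q w v i"
      by (simp only: sum_subtractf Q_flip) (simp add: Q_def)
    finally show ?thesis using anti[OF observable_moments(2)] by simp
  qed
  have V: "poisson_bracket (momv (int i)) (I_fun l) z = 2 * Q u v i - 2 * Q v u i" if i: "i \<ge> 1" for i
  proof -
    have wv: "poisson_bracket (momw (int j)) (momv (int i)) z = - 2 * u (i + j)" if "j \<ge> 1" for j
      using poisson_bracket_anticommute[OF observable_moments(1)[OF that] observable_moments(3)[of i], of z]
        bracket_v_w[of "int i" "int j" z] that i
      by (simp add: u_def flip: of_nat_add)
    have uv: "poisson_bracket (momu (int j)) (momv (int i)) z = - v (i + j)" for j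
      using poisson_bracket_anticommute[OF observable_moments(2)[of j] observable_moments(3)[of i], of z]
        bracket_v_u[of "int i" "int j" z] i
      by (simp add: v_def flip: of_nat_add)
    have "poisson_bracket (I_fun l) (momv (int i)) z =
        (\<Sum>j=1..l. 2 * (v (l + 1 - j) * u (i + j)) - u j * v (i + (l + 1 - j)) - u (l + 1 - j) * v (i + j))"
      unfolding bracket_I_fun[OF observable_moments(3)]
    proof (rule sum.cong[OF refl], goal_cases)
      case (1 j)
      define j' where "j' = l + 1 - j"
      have "j \<ge> 1" "j' \<ge> 1" using 1 by (auto simp: j'_def)
      with i show ?case unfolding j'_def[symmetric]
        using bracket_v_v[of "int j'" "int i" z] uv[of j] uv[of j'] wv[of j]
        by (simp add: v_def w_def u_def del: of_nat_diff)
    qed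
    also have "\<dots> = 2 * Q v u i - 2 * Q u v i"
      by (simp only: sum_subtractf sum_distrib_left[symmetric] Q_flip) (simp add: Q_def)
    finally show ?thesis using anti[OF observable_moments(3)] by simp
  qed
  \<comment> \<open>The analogue of \<open>Q\<close> for the outer index \<open>i\<close>; nesting
    the two gives \<open>hankel_sum\<close>.\<close>
  define P where "P f b = (\<Sum>i=1..k. f i * b (k + 1 - i))" for f b :: "nat \<Rightarrow> complex"
  have P_flip: "(\<Sum>i=1..k. f (k + 1 - i) * b i) = P f b" for f b
    unfolding P_def by (subst sum_flip[symmetric]) (auto intro!: sum.cong)
  have PQ: "P f (Q g h) = hankel_sum k l f g h" for f g h
    unfolding P_def Q_def hankel_sum_def sum_distrib_left by (simp add: mult.assoc)
  have P_diff: "P f (\<lambda>i. a i - b i) = P f a - P f b" for f a b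
    unfolding P_def by (simp add: right_diff_distrib sum_subtractf)
  have P_cmult: "P f (\<lambda>i. c * a i) = c * P f a" for f a c
    unfolding P_def sum_distrib_left by (simp add: mult.left_commute)
  have "poisson_bracket (I_fun k) (I_fun l) z = (\<Sum>i=1..k.
      u i * (Q w v (k + 1 - i) - Q v w (k + 1 - i)) + u (k + 1 - i) * (Q w v i - Q v w i)
      - w i * (2 * Q u v (k + 1 - i) - 2 * Q v u (k + 1 - i)) - v (k + 1 - i) * (2 * Q w u i - 2 * Q u w i))"
    unfolding bracket_I_fun[OF observable_I_fun]
  proof (rule sum.cong[OF refl], goal_cases)
    case (1 i)
    define i' where "i' = k + 1 - i"
    have "i \<ge> 1" "i' \<ge> 1" using 1 by (auto simp: i'_def)
    then show ?case unfolding i'_def[symmetric]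
      using W[of i] U[of i] U[of i'] V[of i']
      by (simp add: v_def w_def u_def del: of_nat_diff)
  qed
  also have "\<dots> = P u (\<lambda>i. Q w v i - Q v w i) + P u (\<lambda>i. Q w v i - Q v w i)
      - P w (\<lambda>i. 2 * Q u v i - 2 * Q v u i) - P v (\<lambda>i. 2 * Q w u i - 2 * Q u w i)"
    unfolding sum.distrib sum_subtractf P_flip[of u "\<lambda>i. Q w v i - Q v w i"]
      P_flip[of v "\<lambda>i. 2 * Q w u i - 2 * Q u w i"] by (simp add: P_def)
  also have "\<dots> = 2 * (hankel_sum k l u w v - hankel_sum k l u v w - hankel_sum k l w u v
      + hankel_sum k l w v u + hankel_sum k l v u w - hankel_sum k l v w u)"
    by (simp add: P_diff P_cmult PQ algebra_simps)
  also have "\<dots> = 0" by (subst hankel_sum_antisym) (simp_all add: u_def v_def w_def)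
  finally show ?thesis .
qed

theorem theorem1:
  shows "(\<forall>k\<ge>1. analytic_integral (I_fun k) Ham) \<and>
         (\<forall>k\<ge>1. \<forall>l\<ge>1. poisson_commute (I_fun k) (I_fun l))"
proof -
  have "observable Ham" unfolding Ham_eq by (rule observable_momv) simp
  moreover have "complex_analytic_on (I_fun k) UNIV" for k
    using observable_I_fun[of k] by (intro polynomial_at_analytic) (simp add: observable_def del: split_paired_All)
  ultimately show ?thesis
    by (simp add: analytic_integral_def poisson_commute_def bracket_I_fun_Ham bracket_I_fun_I_fun
        observable_poisson_defined observable_I_fun)
qed

end
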